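(* Let $\alpha\in(0,1)$ be irrational. Let $M=\mathbb{R}/\mathbb{Z}$ be the circle of length $1$, let $R_\alpha:M\to M$, $R_\alpha(x)=x+\alpha$, be the rotation by $\alpha$, let $U\subset M$ be an arc of length $\alpha$, and let $x_m$ be the midpoint of $U$. Let $p=(p_n)_{n\in\mathbb{Z}}$ be the two-sided infinite word over $\{0,1\}$ generated by the symbolic dynamics $(M,R_\alpha,x_m,U)$, that is, $p_n=1$ if $R_\alpha^n(x_m)\in U$ and $p_n=0$ otherwise. Then $p$ is a substitutive two-sided infinite palindrome if and only if $\alpha$ is a quadratic irrationality.
   Context: A two-sided infinite word over an alphabet $A$ is a map $w:\mathbb{Z}\to A$; write $w_n=w(n)$. Here $A=\{0,1\}$ throughout. A two-sided infinite word $w$ is a palindrome if either $w_n=w_{-n}$ for all $n\in\mathbb{Z}$ (symmetric about a letter), or $w_n=w_{1-n}$ for all $n\in\mathbb{Z}$ (symmetric about an inter-letter position). A substitution is a map assigning to each letter of $A$ a nonempty finite word over $A$, extended to finite words by concatenation. It is applied to a two-sided infinite word by applying it separately to the left half (positions $\le 0$) and to the right half (positions $\ge 1$), so that the image of the left half ends at position $0$ and the image of the right half begins at position $1$. A two-sided infinite word $w$ is purely substitutive if there are letters $a,b\in A$ and a substitution $\phi$ with $\phi(a)=Va$ and $\phi(b)=bW$ for some nonempty finite words $V,W$ over $A$, such that $w=\phi^\infty(a|b)$. This means that the left half of $w$ (positions from $-\infty$ to $0$ inclusive) is the left-infinite word having every $\phi^n(a)$, $n\ge 0$, as a suffix, and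 the right half of $w$ (positions $\ge 1$) is the right-infinite word having every $\phi^n(b)$, $n\ge 0$, as a prefix. A two-sided infinite word $w$ is substitutive if $w=h(w')$ for some purely substitutive two-sided infinite word $w'$ and some substitution $h$. A quadratic irrationality is an irrational real number that is a root of a quadratic polynomial with integer coefficients. *)

theory Defs
  imports Complex_Main "HOL-Library.Z2"
begin

type_synonym 'a biword = "int \<Rightarrow> 'a"

definition palindrome :: "'a biword \<Rightarrow> bool" where
  "palindrome w \<longleftrightarrow> (\<forall>n. w n = w (- n)) \<or> (\<forall>n. w n = w (1 - n))"

definition substitution :: "('a \<Rightarrow> 'a list) \<Rightarrow> bool" where
  "substitution \<phi> \<longleftrightarrow> (\<forall>c. \<phi> c \<noteq> [])"

definition apply_word :: "('a \<Rightarrow> 'a list) \<Rightarrow> 'a list \<Rightarrow> 'a list" where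
  "apply_word \<phi> u = concat (map \<phi> u)"

text \<open>
  For \<open>n \<ge> 1\<close>, the word \<open>h (w 1) \<dots> h (w n)\<close> begins at position 1 of the image
  and, the images of letters being nonempty, reaches at least up to position \<open>n\<close>;
  symmetrically, for \<open>n \<le> 0\<close>, the word \<open>h (w n) \<dots> h (w 0)\<close> ends at position 0
  and reaches at least down to position \<open>n\<close>.
\<close>

definition apply_biword :: "('a \<Rightarrow> 'a list) \<Rightarrow> 'a biword \<Rightarrow> 'a biword" where
  "apply_biword h w n =
     (if n \<ge> 1 then apply_word h (map w [1..n]) ! nat (n - 1)
      else rev (apply_word h (map w [n..0])) ! nat (- n))"

definition suffix_of_left_half :: "'a list \<Rightarrow> 'a biword \<Rightarrow> bool" where
  "suffix_of_left_half u w \<longleftrightarrow> u = map w [1 - int (length u)..0]"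

definition prefix_of_right_half :: "'a list \<Rightarrow> 'a biword \<Rightarrow> bool" where
  "prefix_of_right_half u w \<longleftrightarrow> u = map w [1..int (length u)]"

definition purely_substitutive :: "'a biword \<Rightarrow> bool" where
  "purely_substitutive w \<longleftrightarrow>
     (\<exists>a b \<phi> V W. substitution \<phi> \<and> V \<noteq> [] \<and> W \<noteq> [] \<and> \<phi> a = V @ [a] \<and> \<phi> b = b # W \<and>
        (\<forall>n. suffix_of_left_half ((apply_word \<phi> ^^ n) [a]) w) \<and>
        (\<forall>n. prefix_of_right_half ((apply_word \<phi> ^^ n) [b]) w))"

definition substitutive :: "'a biword \<Rightarrow> bool" where
  "substitutive w \<longleftrightarrow>
     (\<exists>w' h. purely_substitutive w' \<and> substitution h \<and> w = apply_biword h w')"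

quotient_type circle = real / "\<lambda>x y :: real. x - y \<in> \<int>"
  morphisms rep_circle to_circle
proof (rule equivpI)
  show "reflp (\<lambda>x y :: real. x - y \<in> \<int>)"
    by (simp add: reflp_def)
  show "symp (\<lambda>x y :: real. x - y \<in> \<int>)"
    by (metis (no_types, lifting) Ints_minus minus_diff_eq sympI)
  show "transp (\<lambda>x y :: real. x - y \<in> \<int>)"
  proof (rule transpI)
    fix x y z :: real
    assume "x - y \<in> \<int>" "y - z \<in> \<int>"
    then have "(x - y) + (y - z) \<in> \<int>"
      by (rule Ints_add)
    then show "x - z \<in> \<int>"
      by simp
  qed
qed

lift_definition rotation :: "real \<Rightarrow> circle \<Rightarrow> circle" is "\<lambda>\<alpha> x. x + \<alpha>"
  by simp

text \<open>
  \<open>U\<close> is an arc of length \<open>l\<close> with midpoint \<open>m\<close> (used for \<open>0 < l < 1\<close>);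
  each of the two endpoints may or may not belong to the arc.
\<close>

definition is_arc :: "circle set \<Rightarrow> real \<Rightarrow> circle \<Rightarrow> bool" where
  "is_arc U l m \<longleftrightarrow>
     (\<exists>c I. m = to_circle c \<and> {c - l / 2 <..< c + l / 2} \<subseteq> I \<and> I \<subseteq> {c - l / 2 .. c + l / 2} \<and>
        U = to_circle ` I)"

definition int_iterate :: "('m \<Rightarrow> 'm) \<Rightarrow> int \<Rightarrow> 'm \<Rightarrow> 'm" where
  "int_iterate f n = (if n \<ge> 0 then f ^^ nat n else inv f ^^ nat (- n))"

definition symbolic_word :: "('m \<Rightarrow> 'm) \<Rightarrow> 'm \<Rightarrow> 'm set \<Rightarrow> bit biword" where
  "symbolic_word f x U n = (if int_iterate f n x \<in> U then 1 else 0)"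

definition quadratic_irrationality :: "real \<Rightarrow> bool" where
  "quadratic_irrationality x \<longleftrightarrow>
     x \<notin> \<rat> \<and> (\<exists>a b c :: int. a \<noteq> 0 \<and> of_int a * x\<^sup>2 + of_int b * x + of_int c = 0)"

end

theory Submission
  imports Defs "HOL-Library.Quadratic_Discriminant"
begin

text \<open>The word \<open>p\<close> is the Sturmian word of slope \<open>\<alpha>\<close> and intercept \<open>\<alpha>/2\<close>, and it is always a
  palindrome.

  If \<open>\<alpha>\<close> is quadratic, desubstitute \<open>p\<close> repeatedly by deleting a 0 before or after every 1, having
  exchanged the letters whenever the slope exceeds \<open>1/2\<close>. The slopes run through the slow continued
  fraction of \<open>\<alpha>\<close>, and they satisfy integral quadratic equations of fixed discriminant and bounded
  leading coefficient. The intercepts keep the form \<open>(i \<beta> + j)/2\<close> with bounded integers \<open>i\<close> and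
  \<open>j\<close>. So some word recurs, hence is fixed by a substitution, and \<open>p\<close> is an image of it.

  Conversely, if \<open>p\<close> is the image under \<open>h\<close> of a word generated by \<open>\<phi>\<close>, then the letter frequencies
  in \<open>\<phi>\<^sup>n(b)\<close> converge to an irrational fixed point of the integral Moebius map of \<open>\<phi>\<close>, and
  \<open>\<alpha>\<close> is the image of this quadratic number under the Moebius map of \<open>h\<close>.\<close>

section \<open>Images of two-sided words\<close>

text \<open>\<open>P m\<close> is the position at which the image of the letter \<open>v m\<close>
  ends. The condition \<open>P 0 = 0\<close> sends the cut between positions 0 and 1 of
  \<open>v\<close> to the same cut of \<open>w\<close>. With explicit cut positions both halves are
  treated alike and images compose.\<close>

definition image_via :: "('a \<Rightarrow> 'a list) \<Rightarrow> 'a biword \<Rightarrow> 'a biword \<Rightarrow> (int \<Rightarrow> int) \<Rightarrow> bool" where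
  "image_via h v w P \<longleftrightarrow>
     P 0 = 0 \<and> (\<forall>m. P (m - 1) < P m \<and> h (v m) = map w [P (m - 1) + 1..P m])"

lemma image_viaD:
  assumes "image_via h v w P"
  shows "P 0 = 0" "P (m - 1) < P m" "h (v m) = map w [P (m - 1) + 1..P m]"
  using assms unfolding image_via_def by auto

lemma apply_word_Nil [simp]: "apply_word h [] = []"
  by (simp add: apply_word_def)

lemma apply_word_Cons [simp]: "apply_word h (c # u) = h c @ apply_word h u"
  by (simp add: apply_word_def)

lemma apply_word_append [simp]: "apply_word h (u @ v) = apply_word h u @ apply_word h v"
  by (simp add: apply_word_def)

lemma upto_append:
  fixes a b c :: int
  assumes "a \<le> b" "b \<le> c"
  shows "[a + 1..b] @ [b + 1..c] = [a + 1..c]"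
  using assms upto_split2[of "a + 1" b c] by (cases "a = b") auto

lemma image_via_offset:
  assumes "image_via h v w P"
  shows "P a + int k \<le> P (a + int k)"
proof (induction k)
  case (Suc k)
  then show ?case
    using image_viaD(2)[OF assms, of "a + int (Suc k)"] by (simp add: algebra_simps)
qed simp

lemma image_via_block:
  assumes "image_via h v w P" "a \<le> b"
  shows "apply_word h (map v [a + 1..b]) = map w [P a + 1..P b]"
  using assms(2)
proof (induction b rule: int_ge_induct)
  case (step b)
  have le: "P a \<le> P b"
    using image_via_offset[OF assms(1), of a "nat (b - a)"] step.hyps by simp
  have lt: "P b < P (b + 1)" and blk: "h (v (b + 1)) = map w [P b + 1..P (b + 1)]"
    using image_viaD(2,3)[OF assms(1), of "b + 1"] by simp_all
  have "[a + 1..b + 1] = [a + 1..b] @ [b + 1]"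
    using step.hyps upto_rec2[of "a + 1" "b + 1"] by simp
  then have "apply_word h (map v [a + 1..b + 1]) = map w ([P a + 1..P b] @ [P b + 1..P (b + 1)])"
    using step.IH blk by simp
  then show ?case
    using upto_append[of "P a" "P b" "P (b + 1)"] le lt by simp
qed simp

lemma image_via_comp:
  assumes "image_via h v w P" "image_via g u v Q"
  shows "image_via (\<lambda>c. apply_word h (g c)) u w (P \<circ> Q)"
  unfolding image_via_def
proof (intro conjI allI)
  show "(P \<circ> Q) 0 = 0"
    using image_viaD(1)[OF assms(1)] image_viaD(1)[OF assms(2)] by simp
  fix m
  have lt: "Q (m - 1) < Q m"
    using image_viaD(2)[OF assms(2)] .
  show "(P \<circ> Q) (m - 1) < (P \<circ> Q) m"
    using image_via_offset[OF assms(1), of "Q (m - 1)" "nat (Q m - Q (m - 1))"] lt by simp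
  show "apply_word h (g (u m)) = map w [(P \<circ> Q) (m - 1) + 1..(P \<circ> Q) m]"
    using image_viaD(3)[OF assms(2), of m] image_via_block[OF assms(1), of "Q (m - 1)" "Q m"] lt
    by simp
qed

lemma image_via_id: "image_via (\<lambda>c. [c]) w w id"
  unfolding image_via_def by simp

text \<open>As \<open>P\<close> expands distances and fixes 0, the image of the positions from 1 to
  \<open>n\<close>, or from \<open>n\<close> to 0, reaches position \<open>n\<close>. So the index
  used by \<open>apply_biword\<close> falls inside the block.\<close>

lemma image_via_apply_biword:
  assumes "image_via h v w P"
  shows "apply_biword h v = w"
proof
  fix n :: int
  have P0: "P 0 = 0"
    using image_viaD(1)[OF assms] .
  show "apply_biword h v n = w n"
  proof (cases "n \<ge> 1")
    case True
    have "n \<le> P n"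
      using image_via_offset[OF assms, of 0 "nat n"] True P0 by simp
    then show ?thesis
      using True image_via_block[OF assms, of 0 n] P0 by (simp add: apply_biword_def)
  next
    case False
    have P: "P (n - 1) \<le> n - 1"
      using image_via_offset[OF assms, of "n - 1" "nat (1 - n)"] False P0 by simp
    have "apply_word h (map v [n..0]) = map w [P (n - 1) + 1..0]"
      using False image_via_block[OF assms, of "n - 1" 0] P0 by simp
    then show ?thesis
      using False P by (simp add: apply_biword_def rev_nth)
  qed
qed

section \<open>Two-sided words fixed by a substitution\<close>

lemma image_via_funpow:
  assumes "image_via h w w P"
  shows "\<exists>Q. image_via (\<lambda>c. (apply_word h ^^ n) [c]) w w Q"
proof (induction n)
  case 0
  then show ?case
    using image_via_id by auto
next
  case (Suc n)
  then show ?case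
    using image_via_comp[OF assms] by auto
qed

text \<open>The block of \<open>w 0\<close> ends at position 0 and that of \<open>w 1\<close> begins
  at position 1, so \<open>h (w 0)\<close> ends with \<open>w 0\<close> and \<open>h (w 1)\<close>
  begins with \<open>w 1\<close>. Every power of \<open>h\<close> fixes \<open>w\<close> in the same
  way, and the length bound makes \<open>V\<close> and \<open>W\<close> nonempty.\<close>

lemma purely_substitutive_if_image_via_self:
  assumes im: "image_via h w w P" and len: "\<And>c. length (h c) \<ge> 2"
  shows "purely_substitutive w"
proof -
  have suf: "\<exists>k\<le>0. g (w 0) = map w [k..0]" if "image_via g w w Q" for g Q
    using image_viaD(1)[OF that] image_viaD(2,3)[OF that, of 0] by (intro exI[of _ "Q (- 1) + 1"]) auto
  have pre: "\<exists>k\<ge>1. g (w 1) = map w [1..k]" if "image_via g w w Q" for g Q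
    using image_viaD(1)[OF that] image_viaD(2,3)[OF that, of 1] by (intro exI[of _ "Q 1"]) auto
  obtain k where k: "k \<le> 0" "h (w 0) = map w [k..0]"
    using suf[OF im] by blast
  then have 1: "h (w 0) = map w [k..- 1] @ [w 0]"
    using upto_rec2[of k 0] by simp
  obtain l where l: "l \<ge> 1" "h (w 1) = map w [1..l]"
    using pre[OF im] by blast
  then have 2: "h (w 1) = w 1 # map w [2..l]"
    using upto_rec1[of 1 l] by simp
  have "substitution h"
    using len unfolding substitution_def by (metis list.size(3) not_numeral_le_zero)
  moreover have "map w [k..- 1] \<noteq> []"
    using len[of "w 0"] 1 by auto
  moreover have "map w [2..l] \<noteq> []"
    using len[of "w 1"] 2 by auto
  moreover have "suffix_of_left_half ((apply_word h ^^ n) [w 0]) w" for n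
  proof -
    obtain k where "k \<le> 0" "(apply_word h ^^ n) [w 0] = map w [k..0]"
      using image_via_funpow[OF im, of n] suf by blast
    then show ?thesis
      by (simp add: suffix_of_left_half_def)
  qed
  moreover have "prefix_of_right_half ((apply_word h ^^ n) [w 1]) w" for n
  proof -
    obtain k where "k \<ge> 1" "(apply_word h ^^ n) [w 1] = map w [1..k]"
      using image_via_funpow[OF im, of n] pre by blast
    then show ?thesis
      by (simp add: prefix_of_right_half_def)
  qed
  ultimately show ?thesis
    unfolding purely_substitutive_def using 1 2 by blast
qed

section \<open>Desubstitution of Sturmian words\<close>

text \<open>Letter \<open>n\<close> is the increment of the floor from \<open>n - 1\<close> to
  \<open>n\<close>, so the floor at \<open>n\<close> minus the floor at 0 counts the ones at
  positions 1 to \<open>n\<close>.\<close>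

definition sturm :: "real \<Rightarrow> real \<Rightarrow> bit biword" where
  "sturm \<beta> \<rho> n = (if \<lfloor>of_int n * \<beta> + \<rho>\<rfloor> = \<lfloor>of_int (n - 1) * \<beta> + \<rho>\<rfloor> then 0 else 1)"

definition insert0_before :: "bit \<Rightarrow> bit list" where
  "insert0_before c = (if c = 0 then [0] else [0, 1])"

definition insert0_after :: "bit \<Rightarrow> bit list" where
  "insert0_after c = (if c = 0 then [0] else [1, 0])"

lemma upto_pair: "[a + 1..a + 2] = [a + 1, a + 2]" for a :: int
  using upto_rec1[of "a + 1" "a + 2"] upto_single[of "a + 2"] by (simp add: algebra_simps)

lemma floor_increment:
  fixes \<beta> \<rho> :: real
  assumes "0 \<le> \<beta>" "\<beta> < 1"
  shows "\<lfloor>of_int n * \<beta> + \<rho>\<rfloor> = \<lfloor>of_int (n - 1) * \<beta> + \<rho>\<rfloor> \<or>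
    \<lfloor>of_int n * \<beta> + \<rho>\<rfloor> = \<lfloor>of_int (n - 1) * \<beta> + \<rho>\<rfloor> + 1"
proof -
  have "of_int (n - 1) * \<beta> + \<rho> \<le> of_int n * \<beta> + \<rho>"
    "of_int n * \<beta> + \<rho> \<le> of_int (n - 1) * \<beta> + \<rho> + 1"
    using assms by (simp_all add: algebra_simps)
  then have "\<lfloor>of_int (n - 1) * \<beta> + \<rho>\<rfloor> \<le> \<lfloor>of_int n * \<beta> + \<rho>\<rfloor>"
    "\<lfloor>of_int n * \<beta> + \<rho>\<rfloor> \<le> \<lfloor>of_int (n - 1) * \<beta> + \<rho>\<rfloor> + 1"
    using floor_mono[of "of_int n * \<beta> + \<rho>" "of_int (n - 1) * \<beta> + \<rho> + 1"]
    by (simp_all add: floor_mono)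
  then show ?thesis
    by linarith
qed

text \<open>Each 1 lengthens its block by one letter and \<open>F\<close> counts the ones, whence
  \<open>P m = m + F m\<close>. Multiplying the floor inequalities for \<open>F m\<close> by
  \<open>1 - \<beta>\<close> places \<open>P m * \<beta> + \<rho>\<close> between \<open>F m\<close>
  and \<open>F m + 1 - \<beta>\<close>. So the floor does not move from \<open>P m\<close> to
  \<open>P m + 1\<close>: every block starts with 0.\<close>

lemma image_via_insert0_before:
  fixes \<beta> \<rho> :: real
  assumes \<beta>: "0 < \<beta>" "\<beta> < 1/2" and \<rho>: "0 \<le> \<rho>" "\<rho> < 1 - \<beta>"
  shows "\<exists>P. image_via insert0_before (sturm (\<beta> / (1 - \<beta>)) (\<rho> / (1 - \<beta>))) (sturm \<beta> \<rho>) P"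
proof -
  define F :: "int \<Rightarrow> int" where "F m = \<lfloor>of_int m * (\<beta> / (1 - \<beta>)) + \<rho> / (1 - \<beta>)\<rfloor>" for m
  define G :: "int \<Rightarrow> int" where "G n = \<lfloor>of_int n * \<beta> + \<rho>\<rfloor>" for n
  define P where "P m = m + F m" for m
  have s: "sturm \<beta> \<rho> n = (if G n = G (n - 1) then 0 else 1)" for n
    by (simp add: sturm_def G_def)
  have s': "sturm (\<beta> / (1 - \<beta>)) (\<rho> / (1 - \<beta>)) m = (if F m = F (m - 1) then 0 else 1)" for m
    by (simp add: sturm_def F_def)
  \<comment> \<open>The bound \<open>\<rho> < 1 - \<beta>\<close> enters here and makes the origin a
    block boundary.\<close>
  have F0: "F 0 = 0"
    using \<beta> \<rho> by (simp add: F_def floor_eq_iff field_simps)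
  have inc: "F m = F (m - 1) \<or> F m = F (m - 1) + 1" for m
    unfolding F_def by (rule floor_increment) (use \<beta> in \<open>auto simp: field_simps\<close>)
  have G: "G (P m) = F m" "G (P m + 1) = F m" for m
  proof -
    have "of_int m * (\<beta> / (1 - \<beta>)) + \<rho> / (1 - \<beta>) = (of_int m * \<beta> + \<rho>) / (1 - \<beta>)"
      by (simp add: add_divide_distrib)
    then have "of_int (F m) \<le> (of_int m * \<beta> + \<rho>) / (1 - \<beta>)"
      "(of_int m * \<beta> + \<rho>) / (1 - \<beta>) < of_int (F m) + 1"
      unfolding F_def by linarith+
    then have "of_int (F m) * (1 - \<beta>) \<le> of_int m * \<beta> + \<rho>"
      "of_int m * \<beta> + \<rho> < (of_int (F m) + 1) * (1 - \<beta>)"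
      using \<beta> by (simp_all add: pos_le_divide_eq pos_divide_less_eq)
    then show "G (P m) = F m" "G (P m + 1) = F m"
      unfolding G_def floor_eq_iff P_def using \<beta> by (simp_all add: algebra_simps)
  qed
  have "image_via insert0_before (sturm (\<beta> / (1 - \<beta>)) (\<rho> / (1 - \<beta>))) (sturm \<beta> \<rho>) P"
    unfolding image_via_def
  proof (intro conjI allI)
    show "P 0 = 0"
      by (simp add: P_def F0)
    fix m
    show "P (m - 1) < P m"
      using inc[of m] by (auto simp: P_def)
    show "insert0_before (sturm (\<beta> / (1 - \<beta>)) (\<rho> / (1 - \<beta>)) m) =
      map (sturm \<beta> \<rho>) [P (m - 1) + 1..P m]"
      using inc[of m]
    proof
      assume eq: "F m = F (m - 1)"
      then have "P m = P (m - 1) + 1"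
        by (simp add: P_def)
      then show ?thesis
        using G(1)[of "m - 1"] G(2)[of "m - 1"] eq by (simp add: s s' insert0_before_def)
    next
      assume eq: "F m = F (m - 1) + 1"
      then have Pm: "P m = P (m - 1) + 2"
        by (simp add: P_def)
      then have "[P (m - 1) + 1..P m] = [P (m - 1) + 1, P (m - 1) + 2]"
        by (simp add: upto_pair)
      then show ?thesis
        using G(1)[of "m - 1"] G(2)[of "m - 1"] G(1)[of m] eq Pm
        by (simp add: s s' insert0_before_def add.commute)
    qed
  qed
  then show ?thesis
    by blast
qed

text \<open>Mirror image of the previous argument: now \<open>P m * \<beta> + \<rho>\<close> lies
  between \<open>F m + \<beta>\<close> and \<open>F m + 1\<close>, so every block ends with 0, and
  \<open>\<beta> \<le> \<rho>\<close> gives \<open>F 0 = 0\<close>.\<close>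

lemma image_via_insert0_after:
  fixes \<beta> \<rho> :: real
  assumes \<beta>: "0 < \<beta>" "\<beta> < 1/2" and \<rho>: "\<beta> \<le> \<rho>" "\<rho> < 1"
  shows "\<exists>P. image_via insert0_after (sturm (\<beta> / (1 - \<beta>)) ((\<rho> - \<beta>) / (1 - \<beta>))) (sturm \<beta> \<rho>) P"
proof -
  define F :: "int \<Rightarrow> int" where "F m = \<lfloor>of_int m * (\<beta> / (1 - \<beta>)) + (\<rho> - \<beta>) / (1 - \<beta>)\<rfloor>" for m
  define G :: "int \<Rightarrow> int" where "G n = \<lfloor>of_int n * \<beta> + \<rho>\<rfloor>" for n
  define P where "P m = m + F m" for m
  have s: "sturm \<beta> \<rho> n = (if G n = G (n - 1) then 0 else 1)" for n
    by (simp add: sturm_def G_def)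
  have s': "sturm (\<beta> / (1 - \<beta>)) ((\<rho> - \<beta>) / (1 - \<beta>)) m = (if F m = F (m - 1) then 0 else 1)" for m
    by (simp add: sturm_def F_def)
  have F0: "F 0 = 0"
    using \<beta> \<rho> by (simp add: F_def floor_eq_iff field_simps)
  have inc: "F m = F (m - 1) \<or> F m = F (m - 1) + 1" for m
    unfolding F_def by (rule floor_increment) (use \<beta> in \<open>auto simp: field_simps\<close>)
  have G: "G (P m) = F m" "G (P m - 1) = F m" for m
  proof -
    have "of_int m * (\<beta> / (1 - \<beta>)) + (\<rho> - \<beta>) / (1 - \<beta>) = (of_int m * \<beta> + (\<rho> - \<beta>)) / (1 - \<beta>)"
      by (simp add: add_divide_distrib)
    then have "of_int (F m) \<le> (of_int m * \<beta> + (\<rho> - \<beta>)) / (1 - \<beta>)"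
      "(of_int m * \<beta> + (\<rho> - \<beta>)) / (1 - \<beta>) < of_int (F m) + 1"
      unfolding F_def by linarith+
    then have "of_int (F m) * (1 - \<beta>) \<le> of_int m * \<beta> + (\<rho> - \<beta>)"
      "of_int m * \<beta> + (\<rho> - \<beta>) < (of_int (F m) + 1) * (1 - \<beta>)"
      using \<beta> by (simp_all add: pos_le_divide_eq pos_divide_less_eq)
    then show "G (P m) = F m" "G (P m - 1) = F m"
      unfolding G_def floor_eq_iff P_def using \<beta> by (simp_all add: algebra_simps)
  qed
  have "image_via insert0_after (sturm (\<beta> / (1 - \<beta>)) ((\<rho> - \<beta>) / (1 - \<beta>))) (sturm \<beta> \<rho>) P"
    unfolding image_via_def
  proof (intro conjI allI)
    show "P 0 = 0"
      by (simp add: P_def F0)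
    fix m
    show "P (m - 1) < P m"
      using inc[of m] by (auto simp: P_def)
    show "insert0_after (sturm (\<beta> / (1 - \<beta>)) ((\<rho> - \<beta>) / (1 - \<beta>)) m) =
      map (sturm \<beta> \<rho>) [P (m - 1) + 1..P m]"
      using inc[of m]
    proof
      assume eq: "F m = F (m - 1)"
      then have "P m = P (m - 1) + 1"
        by (simp add: P_def)
      then show ?thesis
        using G(1)[of m] G(2)[of m] eq by (simp add: s s' insert0_after_def)
    next
      assume eq: "F m = F (m - 1) + 1"
      then have Pm: "P m = P (m - 1) + 2"
        by (simp add: P_def)
      then have "[P (m - 1) + 1..P m] = [P (m - 1) + 1, P (m - 1) + 2]"
        by (simp add: upto_pair)
      then show ?thesis
        using G(1)[of "m - 1"] G(1)[of m] G(2)[of m] eq Pm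
        by (simp add: s s' insert0_after_def add.commute)
    qed
  qed
  then show ?thesis
    by blast
qed

section \<open>Exchange of letters for non-integral orbits\<close>

definition nondegenerate :: "real \<Rightarrow> real \<Rightarrow> bool" where
  "nondegenerate \<beta> \<rho> \<longleftrightarrow> (\<forall>n k. of_int n * \<beta> + \<rho> \<noteq> of_int k)"

lemma nondegenerate_complement:
  assumes "nondegenerate \<beta> \<rho>"
  shows "nondegenerate (1 - \<beta>) (1 - \<rho>)"
  unfolding nondegenerate_def
proof (intro allI notI)
  fix n k
  assume "of_int n * (1 - \<beta>) + (1 - \<rho>) = of_int k"
  then have "of_int n * \<beta> + \<rho> = of_int (n + 1 - k)"
    by (simp add: algebra_simps)
  then show False
    using assms unfolding nondegenerate_def by blast
qed

text \<open>An integral value \<open>k\<close> at index \<open>n\<close> for the new parameters is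
  an integral value at index \<open>n + k - d\<close> for the old ones. The cases
  \<open>d = 0\<close> and \<open>d = 1\<close> are the two insertions.\<close>

lemma nondegenerate_slow:
  assumes "nondegenerate \<beta> \<rho>" "\<beta> < 1"
  shows "nondegenerate (\<beta> / (1 - \<beta>)) ((\<rho> - of_int d * \<beta>) / (1 - \<beta>))"
  unfolding nondegenerate_def
proof (intro allI notI)
  fix n k
  assume "of_int n * (\<beta> / (1 - \<beta>)) + (\<rho> - of_int d * \<beta>) / (1 - \<beta>) = of_int k"
  then have "(of_int n * \<beta> + (\<rho> - of_int d * \<beta>)) / (1 - \<beta>) = of_int k"
    by (simp add: add_divide_distrib)
  then have "of_int (n + k - d) * \<beta> + \<rho> = of_int k"
    using assms(2) by (simp add: divide_eq_eq algebra_simps)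
  then show False
    using assms unfolding nondegenerate_def by blast
qed

text \<open>Reflecting the values turns floors into ceilings, and on a non-integral orbit these
  differ by exactly 1. Hence the floor moves in exactly one of the two words at each index. In
  \<open>bit\<close>, adding 1 exchanges the letters.\<close>

lemma sturm_complement:
  assumes "nondegenerate \<beta> \<rho>" "0 < \<beta>" "\<beta> < 1"
  shows "sturm \<beta> \<rho> = (\<lambda>c. c + 1) \<circ> sturm (1 - \<beta>) (1 - \<rho>)"
proof
  fix n
  have fl: "\<lfloor>of_int n * (1 - \<beta>) + (1 - \<rho>)\<rfloor> = n - \<lfloor>of_int n * \<beta> + \<rho>\<rfloor>" for n
  proof -
    have "of_int \<lfloor>of_int n * \<beta> + \<rho>\<rfloor> \<noteq> of_int n * \<beta> + \<rho>"
      using assms(1) unfolding nondegenerate_def by metis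
    then have "of_int \<lfloor>of_int n * \<beta> + \<rho>\<rfloor> < of_int n * \<beta> + \<rho>"
      by (simp add: less_le)
    then show ?thesis
      unfolding floor_eq_iff by (simp add: algebra_simps) linarith
  qed
  show "sturm \<beta> \<rho> n = ((\<lambda>c. c + 1) \<circ> sturm (1 - \<beta>) (1 - \<rho>)) n"
    using floor_increment[of \<beta> n \<rho>] assms(2,3) fl[of n] fl[of "n - 1"]
    unfolding sturm_def comp_def by auto
qed

lemma image_via_map:
  assumes "image_via h v w P"
  shows "image_via (\<lambda>c. map f (h c)) v (f \<circ> w) P"
  using assms unfolding image_via_def by simp

section \<open>Desubstitution as a map on pairs of slope and intercept\<close>

text \<open>Both insertions desubstitute a Sturmian word without two adjacent ones. The case distinction
  on \<open>\<rho>\<close> ensures that the boundary between positions 0 and 1 does not cut a block.\<close>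

fun slow_step :: "real \<times> real \<Rightarrow> real \<times> real" where
  "slow_step (\<beta>, \<rho>) =
    (\<beta> / (1 - \<beta>), (if \<rho> < 1 - \<beta> then \<rho> / (1 - \<beta>) else (\<rho> - \<beta>) / (1 - \<beta>)))"

fun slow_subst :: "real \<times> real \<Rightarrow> bit \<Rightarrow> bit list" where
  "slow_subst (\<beta>, \<rho>) = (if \<rho> < 1 - \<beta> then insert0_before else insert0_after)"

fun complement_state :: "real \<times> real \<Rightarrow> real \<times> real" where
  "complement_state (\<beta>, \<rho>) = (1 - \<beta>, 1 - \<rho>)"

definition step :: "real \<times> real \<Rightarrow> real \<times> real" where
  "step x = (if fst x < 1/2 then slow_step x else slow_step (complement_state x))"

text \<open>The exchange acts on the images only: \<open>step x\<close> describes the preimage of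
  the complemented word, and that preimage is not complemented back.\<close>

definition step_subst :: "real \<times> real \<Rightarrow> bit \<Rightarrow> bit list" where
  "step_subst x = (if fst x < 1/2 then slow_subst x
     else (\<lambda>c. map (\<lambda>c. c + 1) (slow_subst (complement_state x) c)))"

definition word :: "real \<times> real \<Rightarrow> bit biword" where
  "word x = sturm (fst x) (snd x)"

text \<open>Slope 1/2 is excluded because it equals its own complement and a slow step would send it
  to slope 1.\<close>

definition valid :: "real \<times> real \<Rightarrow> bool" where
  "valid x \<longleftrightarrow> 0 < fst x \<and> fst x < 1 \<and> fst x \<noteq> 1/2 \<and> 0 < snd x \<and> snd x < 1 \<and>
     nondegenerate (fst x) (snd x)"

lemma valid_complement: "valid x \<Longrightarrow> valid (complement_state x)"
  using nondegenerate_complement by (cases x) (auto simp: valid_def)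

lemma image_via_slow:
  assumes "valid x" "fst x < 1/2"
  shows "\<exists>P. image_via (slow_subst x) (word (slow_step x)) (word x) P"
  using assms image_via_insert0_before[of "fst x" "snd x"] image_via_insert0_after[of "fst x" "snd x"]
  by (cases x) (auto simp: valid_def word_def)

lemma image_via_step:
  assumes "valid x"
  shows "\<exists>P. image_via (step_subst x) (word (step x)) (word x) P"
proof (cases "fst x < 1/2")
  case True
  then show ?thesis
    using image_via_slow[OF assms] by (simp add: step_def step_subst_def)
next
  case False
  then have "fst (complement_state x) < 1/2"
    using assms by (cases x) (auto simp: valid_def)
  then obtain P where "image_via (slow_subst (complement_state x))
      (word (slow_step (complement_state x))) (word (complement_state x)) P"
    using image_via_slow[OF valid_complement[OF assms]] by blast
  moreover have "word x = (\<lambda>c. c + 1) \<circ> word (complement_state x)"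
    using sturm_complement assms by (cases x) (simp add: word_def valid_def)
  ultimately show ?thesis
    unfolding step_def step_subst_def if_not_P[OF False] using image_via_map by metis
qed

section \<open>Composed substitutions along an orbit\<close>

primrec tower :: "real \<times> real \<Rightarrow> nat \<Rightarrow> bit \<Rightarrow> bit list" where
  "tower x 0 = (\<lambda>c. [c])"
| "tower x (Suc n) = (\<lambda>c. apply_word (tower x n) (step_subst ((step ^^ n) x) c))"

lemma image_via_tower:
  assumes "\<And>k. k < n \<Longrightarrow> valid ((step ^^ k) x)"
  shows "\<exists>P. image_via (tower x n) (word ((step ^^ n) x)) (word x) P"
  using assms
proof (induction n)
  case 0
  then show ?case
    using image_via_id by auto
next
  case (Suc n)
  obtain P where "image_via (tower x n) (word ((step ^^ n) x)) (word x) P"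
    using Suc by force
  moreover obtain Q where
    "image_via (step_subst ((step ^^ n) x)) (word (step ((step ^^ n) x))) (word ((step ^^ n) x)) Q"
    using image_via_step Suc.prems by blast
  ultimately show ?case
    using image_via_comp by fastforce
qed

text \<open>Under \<open>step_subst\<close> the letter 0 goes to a single letter, which is 1 exactly
  when the letters were exchanged, and the letter 1 goes to a word with one letter of each
  kind.\<close>

lemma length_tower_Suc:
  "length (tower x (Suc n) 0) =
    (if fst ((step ^^ n) x) < 1/2 then length (tower x n 0) else length (tower x n 1))"
  "length (tower x (Suc n) 1) = length (tower x n 0) + length (tower x n 1)"
  by (cases "(step ^^ n) x"; simp add: step_subst_def insert0_before_def insert0_after_def)+

lemma length_tower_pos: "0 < length (tower x n 0)" "0 < length (tower x n 1)"
  by (induction n) (auto simp: length_tower_Suc simp del: tower.simps(2))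

lemma length_tower_1_ge_2: "n \<ge> 1 \<Longrightarrow> length (tower x n 1) \<ge> 2"
  using length_tower_pos[of x "n - 1"]
  by (cases n) (simp_all add: length_tower_Suc del: tower.simps(2) length_greater_0_conv)

text \<open>At step \<open>t\<close> the image of 0 takes over the length of the image of 1, which
  is at least 2 as \<open>t \<ge> 1\<close>. Each later step either keeps the image length of 0 or
  again takes over that of 1.\<close>

lemma length_tower_0_ge_2:
  assumes "1 \<le> t" "\<not> fst ((step ^^ t) x) < 1/2" "t < n"
  shows "length (tower x n 0) \<ge> 2"
  using assms(3)
proof (induction n)
  case (Suc n)
  show ?case
  proof (cases "t = n")
    case True
    then show ?thesis
      using assms length_tower_1_ge_2[of n x] by (simp add: length_tower_Suc del: tower.simps(2))
  next
    case False
    then show ?thesis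
      using Suc length_tower_1_ge_2[of n x] by (simp add: length_tower_Suc del: tower.simps(2))
  qed
qed simp

lemma fst_slow_step: "fst (slow_step x) = fst x / (1 - fst x)"
  by (cases x) simp

text \<open>While \<open>\<beta> < 1/2\<close>, a step decreases \<open>1 / \<beta>\<close> by 1.\<close>

lemma periodic_leaves_lower_half:
  assumes "(step ^^ k) x = x" "k \<ge> 1" and val: "\<And>n. valid ((step ^^ n) x)"
  shows "\<exists>t<k. \<not> fst ((step ^^ t) x) < 1/2"
proof (rule ccontr)
  assume "\<not> ?thesis"
  then have low: "fst ((step ^^ t) x) < 1/2" if "t < k" for t
    using that by blast
  have "1 / fst ((step ^^ t) x) = 1 / fst x - real t" if "t \<le> k" for t
    using that
  proof (induction t)
    case (Suc t)
    have "0 < fst ((step ^^ t) x)" "fst ((step ^^ t) x) < 1/2"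
      using val[of t] low[of t] Suc.prems by (auto simp: valid_def)
    then have "1 / fst ((step ^^ Suc t) x) = 1 / fst ((step ^^ t) x) - 1"
      by (simp add: step_def fst_slow_step field_simps)
    then show ?case
      using Suc by simp
  qed simp
  from this[of k] show False
    using assms(1,2) by simp
qed

lemma purely_substitutive_if_periodic:
  assumes per: "(step ^^ k) x = x" "k \<ge> 1" and val: "\<And>n. valid ((step ^^ n) x)"
  shows "purely_substitutive (word x)"
proof -
  obtain t where t: "t < k" "\<not> fst ((step ^^ t) x) < 1/2"
    using periodic_leaves_lower_half[OF assms] by blast
  \<comment> \<open>Two periods are composed so that the exchange of letters occurs at the index
    \<open>t + k\<close>, which is positive even if \<open>t = 0\<close>.\<close>
  have "(step ^^ (k + k)) x = x" "(step ^^ (t + k)) x = (step ^^ t) x"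
    using per by (simp_all add: funpow_add)
  then obtain P where "image_via (tower x (k + k)) (word x) (word x) P"
    using image_via_tower[of "k + k" x] val by auto
  moreover have "length (tower x (k + k) c) \<ge> 2" for c
    using length_tower_0_ge_2[of "t + k" x "k + k"] length_tower_1_ge_2[of "k + k" x] t per
      \<open>(step ^^ (t + k)) x = (step ^^ t) x\<close>
    by (cases c) auto
  ultimately show ?thesis
    by (rule purely_substitutive_if_image_via_self)
qed

text \<open>By the pigeonhole principle some state \<open>y\<close> of the orbit is periodic. Its
  word is purely substitutive, and \<open>tower x m\<close> maps it to the word of
  \<open>x\<close>.\<close>

lemma substitutive_if_finite_orbit:
  assumes val: "\<And>n. valid ((step ^^ n) x)" and fin: "finite (range (\<lambda>n. (step ^^ n) x))"
  shows "substitutive (word x)"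
proof -
  have "\<not> inj (\<lambda>n. (step ^^ n) x)"
    using fin finite_imageD infinite_UNIV_nat by blast
  then obtain m n where mn: "m < n" "(step ^^ m) x = (step ^^ n) x"
    unfolding inj_def by (metis linorder_neqE_nat)
  define y where "y = (step ^^ m) x"
  have "(step ^^ (n - m)) y = y"
    using mn unfolding y_def by (metis funpow_add comp_apply le_add_diff_inverse2 less_imp_le)
  moreover have "valid ((step ^^ k) y)" for k
    using val[of "k + m"] by (simp add: y_def funpow_add)
  ultimately have "purely_substitutive (word y)"
    using purely_substitutive_if_periodic[of "n - m" y] mn(1) by simp
  moreover obtain P where "image_via (tower x m) (word y) (word x) P"
    using image_via_tower[of m x] val unfolding y_def by blast
  moreover have "substitution (tower x m)"
    unfolding substitution_def using length_tower_pos[of x m] by (metis bit.exhaust length_0_conv less_irrefl)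
  ultimately show ?thesis
    unfolding substitutive_def using image_via_apply_biword by metis
qed

section \<open>Finiteness of the orbit for quadratic slopes\<close>

text \<open>Bounding the leading coefficient is enough for finiteness: the discriminant and
  \<open>0 < \<beta> < 1\<close> then bound the other two coefficients.\<close>

definition bounded_quadratics :: "int \<Rightarrow> int \<Rightarrow> real set" where
  "bounded_quadratics D K = {\<beta>. 0 < \<beta> \<and> \<beta> < 1 \<and> \<beta> \<notin> \<rat> \<and>
     (\<exists>A B C :: int. A \<noteq> 0 \<and> \<bar>A\<bar> \<le> K \<and> B\<^sup>2 - 4 * A * C = D \<and>
        of_int A * \<beta>\<^sup>2 + of_int B * \<beta> + of_int C = 0)}"

lemma finite_quadratic_roots:
  fixes a b c :: real
  assumes "a \<noteq> 0"
  shows "finite {x. a * x\<^sup>2 + b * x + c = 0}"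
proof (rule finite_subset)
  show "{x. a * x\<^sup>2 + b * x + c = 0} \<subseteq>
    {(- b + sqrt (discrim a b c)) / (2 * a), (- b - sqrt (discrim a b c)) / (2 * a)}"
    using discriminant_iff[OF assms] by blast
qed simp

lemma finite_bounded_quadratics: "finite (bounded_quadratics D K)"
proof -
  define R where "R = (\<lambda>(A :: int, B :: int, C :: int).
    if A = 0 then {} else {x :: real. of_int A * x\<^sup>2 + of_int B * x + of_int C = 0})"
  \<comment> \<open>\<open>L\<close> bounds the middle coefficient through
    \<open>B = y - 2 A \<beta>\<close>, with \<open>y\<close> the derivative of the quadratic at the
    root.\<close>
  define L where "L = \<bar>D\<bar> + 2 * K"
  have "bounded_quadratics D K \<subseteq> (\<Union>t\<in>{- K..K} \<times> {- L..L} \<times> {- (K + L)..K + L}. R t)"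
  proof
    fix \<beta>
    assume "\<beta> \<in> bounded_quadratics D K"
    then obtain A B C :: int where \<beta>: "0 < \<beta>" "\<beta> < 1"
      and A: "A \<noteq> 0" "\<bar>A\<bar> \<le> K" and D: "B\<^sup>2 - 4 * A * C = D"
      and eq: "of_int A * \<beta>\<^sup>2 + of_int B * \<beta> + of_int C = 0"
      unfolding bounded_quadratics_def by auto
    define y where "y = 2 * of_int A * \<beta> + of_int B"
    have "y\<^sup>2 = 4 * of_int A * (of_int A * \<beta>\<^sup>2 + of_int B * \<beta> + of_int C)
        + of_int (B\<^sup>2 - 4 * A * C)"
      by (simp add: y_def power2_eq_square algebra_simps)
    then have y2: "y\<^sup>2 = of_int D"
      using eq D by simp
    then have "0 \<le> D"
      by (metis of_int_0_le_iff zero_le_power2)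
    have "\<bar>y\<bar> \<le> of_int \<bar>D\<bar>"
    \<comment> \<open>From \<open>\<bar>y\<bar> > 1\<close> one gets
      \<open>\<bar>y\<bar> \<le> y\<^sup>2\<close>. For small \<open>y\<close> the integrality of
      \<open>D\<close> replaces this: either \<open>D = 0\<close> and \<open>y = 0\<close>, or
      \<open>\<bar>D\<bar> \<ge> 1\<close>.\<close>
    proof (cases "\<bar>y\<bar> \<le> 1")
      case True
      show ?thesis
      proof (cases "D = 0")
        case True
        then show ?thesis
          using y2 by simp
      next
        case False
        then have "1 \<le> \<bar>D\<bar>"
          by simp
        then show ?thesis
          using \<open>\<bar>y\<bar> \<le> 1\<close> by linarith
      qed
    next
      case False
      then have "\<bar>y\<bar> * 1 \<le> \<bar>y\<bar> * \<bar>y\<bar>"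
        by (intro mult_left_mono) auto
      then show ?thesis
        using y2 \<open>0 \<le> D\<close> by (simp add: power2_eq_square)
    qed
    have A\<beta>: "\<bar>of_int A * \<beta>\<bar> \<le> of_int K"
    proof -
      have "\<bar>of_int A\<bar> * \<beta> \<le> \<bar>of_int A\<bar> * 1"
        using \<beta> by (intro mult_left_mono) auto
      then show ?thesis
        using A(2) \<beta> by (simp add: abs_mult)
    qed
    have "\<bar>of_int B\<bar> \<le> (of_int L :: real)"
      using \<open>\<bar>y\<bar> \<le> of_int \<bar>D\<bar>\<close> A\<beta> unfolding y_def L_def by (simp add: mult.assoc)
    then have B: "\<bar>B\<bar> \<le> L"
      by linarith
    have "of_int C = - (\<beta> * (of_int A * \<beta> + of_int B))"
      using eq by (simp add: power2_eq_square algebra_simps)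
    then have "\<bar>of_int C\<bar> = \<beta> * \<bar>of_int A * \<beta> + of_int B\<bar>"
      using \<beta> by (simp add: abs_mult)
    also have "\<dots> \<le> 1 * \<bar>of_int A * \<beta> + of_int B\<bar>"
      using \<beta> by (intro mult_right_mono) auto
    also have "\<dots> \<le> of_int (K + L)"
      using A\<beta> \<open>\<bar>of_int B\<bar> \<le> of_int L\<close> by simp
    finally have C: "\<bar>C\<bar> \<le> K + L"
      by linarith
    have "\<beta> \<in> R (A, B, C)"
      using A eq by (simp add: R_def)
    moreover have "(A, B, C) \<in> {- K..K} \<times> {- L..L} \<times> {- (K + L)..K + L}"
      using A B C by auto
    ultimately show "\<beta> \<in> (\<Union>t\<in>{- K..K} \<times> {- L..L} \<times> {- (K + L)..K + L}. R t)"
      by blast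
  qed
  moreover have "finite (R t)" for t
    using finite_quadratic_roots by (cases t) (auto simp: R_def)
  ultimately show ?thesis
    by (meson finite_UN_I finite_SigmaI finite_atLeastAtMost_int finite_subset)
qed

text \<open>Substituting \<open>1 - x\<close> for \<open>x\<close> in the polynomial preserves the
  leading coefficient and the discriminant.\<close>

lemma bounded_quadratics_complement:
  assumes "\<beta> \<in> bounded_quadratics D K"
  shows "1 - \<beta> \<in> bounded_quadratics D K"
proof -
  obtain A B C :: int where A: "A \<noteq> 0" "\<bar>A\<bar> \<le> K" and D: "B\<^sup>2 - 4 * A * C = D"
    and eq: "of_int A * \<beta>\<^sup>2 + of_int B * \<beta> + of_int C = 0" and \<beta>: "0 < \<beta>" "\<beta> < 1" "\<beta> \<notin> \<rat>"
    using assms unfolding bounded_quadratics_def by auto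
  have "1 - \<beta> \<notin> \<rat>"
    using \<beta>(3) Rats_diff[OF Rats_1, of "1 - \<beta>"] by auto
  moreover have "(- (2 * A + B))\<^sup>2 - 4 * A * (A + B + C) = D"
    using D by (simp add: power2_eq_square algebra_simps)
  moreover have "of_int A * (1 - \<beta>)\<^sup>2 + of_int (- (2 * A + B)) * (1 - \<beta>) + of_int (A + B + C) = 0"
    using eq by (simp add: power2_eq_square algebra_simps)
  moreover have "0 < 1 - \<beta>" "1 - \<beta> < 1"
    using \<beta> by simp_all
  ultimately show ?thesis
    unfolding bounded_quadratics_def using A
    by (intro CollectI conjI exI[of _ A] exI[of _ "- (2 * A + B)"] exI[of _ "A + B + C"])
qed

lemma Rats_slow:
  assumes "\<beta> / (1 - \<beta>) \<in> \<rat>" "0 < \<beta>" "\<beta> < (1 :: real)"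
  shows "\<beta> \<in> \<rat>"
proof -
  define x where "x = \<beta> / (1 - \<beta>)"
  have "x > 0"
    using assms by (simp add: x_def)
  then have "\<beta> = x / (1 + x)"
    using assms by (simp add: x_def field_simps)
  then show ?thesis
    using assms(1) unfolding x_def[symmetric] by simp
qed

text \<open>With \<open>f(x) = A x\<^sup>2 + B x + C\<close>, the new leading coefficient is \<open>f(1)\<close>. If \<open>f(0)\<close> and
  \<open>f(1)\<close> have the same sign then \<open>\<bar>f(1)\<bar> < \<bar>A\<bar>\<close>; otherwise \<open>f(0) f(1) < 0\<close>, and as the
  new constant coefficient is again \<open>f(0)\<close>, the invariant discriminant bounds \<open>4 \<bar>f(1)\<bar>\<close>.\<close>

lemma bounded_quadratics_slow:
  assumes "\<beta> \<in> bounded_quadratics D K" "\<beta> < 1/2" "D \<le> K"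
  shows "\<beta> / (1 - \<beta>) \<in> bounded_quadratics D K"
proof -
  obtain A B C :: int where A: "A \<noteq> 0" "\<bar>A\<bar> \<le> K" and D: "B\<^sup>2 - 4 * A * C = D"
    and eq: "of_int A * \<beta>\<^sup>2 + of_int B * \<beta> + of_int C = 0" and \<beta>: "0 < \<beta>" "\<beta> < 1" "\<beta> \<notin> \<rat>"
    using assms(1) unfolding bounded_quadratics_def by auto
  define S where "S = A + B + C"
  define \<gamma> where "\<gamma> = (1 - \<beta>) / \<beta>"
  have \<gamma>: "\<gamma> > 0"
    using \<beta> by (simp add: \<gamma>_def)
  have \<gamma>\<beta>: "\<gamma> * \<beta> = 1 - \<beta>"
    using \<beta> by (simp add: \<gamma>_def)
  \<comment> \<open>If \<delta> denotes the other root, then \<open>C = A \<beta> \<delta>\<close>,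
    and this is the factorization \<open>S = A (1 - \<beta>) (1 - \<delta>)\<close> of the value at
    1, written without \<delta>.\<close>
  have "of_int S * \<beta> = (1 - \<beta>) * (of_int A * \<beta> - of_int C)"
    using eq by (simp add: S_def power2_eq_square algebra_simps)
  then have S: "of_int S = \<gamma> * (of_int A * \<beta> - of_int C)"
    using \<beta> by (simp add: \<gamma>_def divide_simps)
  have S': "of_int S = of_int A * (1 - \<beta>) - \<gamma> * of_int C"
    unfolding S by (simp add: \<gamma>\<beta>[symmetric] algebra_simps)
  have "C \<noteq> 0"
  proof
    assume "C = 0"
    then have "\<beta> * (of_int A * \<beta> + of_int B) = 0"
      using eq by (simp add: power2_eq_square algebra_simps)
    then have "of_int A * \<beta> + of_int B = 0"
      using \<beta> by simp
    then have "\<beta> = - of_int B / of_int A"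
      using A by (simp add: field_simps)
    then show False
      using \<beta>(3) by simp
  qed
  have "S \<noteq> 0"
  proof
    assume "S = 0"
    then have "of_int A * \<beta> = of_int C"
      using S \<gamma> by simp
    then have "\<beta> = of_int C / of_int A"
      using A by (simp add: field_simps)
    then show False
      using \<beta>(3) by simp
  qed
  \<comment> \<open>Putting \<open>x / (1 + x)\<close> into the old polynomial and clearing
    denominators gives \<open>S x\<^sup>2 + (B + 2 C) x + C\<close>, the polynomial of the new
    slope.\<close>
  have D': "(B + 2 * C)\<^sup>2 - 4 * S * C = D"
    using D by (simp add: S_def power2_eq_square algebra_simps)
  have "\<bar>S\<bar> \<le> K"
  proof (cases "S * C < 0")
    case True
    have "\<bar>S\<bar> * 1 \<le> \<bar>S\<bar> * \<bar>C\<bar>"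
      using \<open>C \<noteq> 0\<close> by (intro mult_left_mono) auto
    also have "\<dots> = - (S * C)"
      using True unfolding abs_mult[symmetric] by simp
    also have "\<dots> \<le> D"
      using D' True zero_le_power2[of "B + 2 * C"] by linarith
    finally show ?thesis
      using assms(3) by simp
  next
    case False
    then have "S > 0 \<and> C > 0 \<or> S < 0 \<and> C < 0"
      using \<open>C \<noteq> 0\<close> \<open>S \<noteq> 0\<close> unfolding not_less zero_le_mult_iff by linarith
    then consider "S > 0" "C > 0" | "S < 0" "C < 0"
      by blast
    then have "\<bar>of_int S\<bar> \<le> \<bar>of_int A :: real\<bar>"
    proof cases
      case 1
      then have "0 < \<gamma> * (of_int A * \<beta> - of_int C)"
        using S by linarith
      then have "of_int C < of_int A * \<beta>"
        using \<gamma> by (simp add: zero_less_mult_iff)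
      then have "0 < of_int A * \<beta>"
        using of_int_0_less_iff[of C, where 'a = real] 1 by linarith
      then have "0 < A"
        using \<beta> by (simp add: zero_less_mult_iff)
      moreover have "0 < \<gamma> * of_int C" "0 < of_int A * \<beta>"
        using \<gamma> 1 \<open>0 < of_int A * \<beta>\<close> by simp_all
      ultimately show ?thesis
        using S' 1 by (simp add: algebra_simps)
    next
      case 2
      then have "\<gamma> * (of_int A * \<beta> - of_int C) < 0"
        using S by linarith
      then have "of_int A * \<beta> < of_int C"
        using \<gamma> by (simp add: mult_less_0_iff)
      then have "of_int A * \<beta> < 0"
        using of_int_less_0_iff[of C, where 'a = real] 2 by linarith
      then have "A < 0"
        using \<beta> by (simp add: mult_less_0_iff)
      moreover have "\<gamma> * of_int C < 0"
        using \<gamma> 2 by (simp add: mult_less_0_iff)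
      ultimately show ?thesis
        using S' 2 \<open>of_int A * \<beta> < 0\<close> by (simp add: algebra_simps)
    qed
    then show ?thesis
      using A(2) by linarith
  qed
  moreover have "\<beta> / (1 - \<beta>) \<notin> \<rat>"
    using Rats_slow[OF _ \<beta>(1,2)] \<beta>(3) by blast
  moreover have "of_int S * (\<beta> / (1 - \<beta>))\<^sup>2 + of_int (B + 2 * C) * (\<beta> / (1 - \<beta>)) + of_int C = 0"
  proof -
    have "of_int S * \<beta>\<^sup>2 + of_int (B + 2 * C) * \<beta> * (1 - \<beta>) + of_int C * (1 - \<beta>)\<^sup>2 = 0"
      using eq by (simp add: S_def power2_eq_square algebra_simps)
    moreover have "of_int S * (\<beta> / (1 - \<beta>))\<^sup>2 + of_int (B + 2 * C) * (\<beta> / (1 - \<beta>)) + of_int C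
      = (of_int S * \<beta>\<^sup>2 + of_int (B + 2 * C) * \<beta> * (1 - \<beta>) + of_int C * (1 - \<beta>)\<^sup>2) / (1 - \<beta>)\<^sup>2"
      using \<beta>(2) by (simp add: add_divide_distrib power_divide power2_eq_square)
    ultimately show ?thesis
      by simp
  qed
  moreover have "0 < \<beta> / (1 - \<beta>)" "\<beta> / (1 - \<beta>) < 1"
    using \<beta> assms(2) by simp_all
  ultimately show ?thesis
    unfolding bounded_quadratics_def using D' \<open>S \<noteq> 0\<close>
    by (intro CollectI conjI exI[of _ S] exI[of _ "B + 2 * C"] exI[of _ C])
qed

section \<open>Finitely many states\<close>

definition states :: "int \<Rightarrow> int \<Rightarrow> real \<Rightarrow> (real \<times> real) set" where
  "states D K I = {x. fst x \<in> bounded_quadratics D K \<and> 0 < snd x \<and> snd x < 1 \<and>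
     nondegenerate (fst x) (snd x) \<and>
     (\<exists>i j :: int. \<bar>of_int i\<bar> \<le> I \<and> 2 * snd x = of_int i * fst x + of_int j)}"

lemma statesI:
  assumes "\<beta> \<in> bounded_quadratics D K" "0 < \<rho>" "\<rho> < 1" "nondegenerate \<beta> \<rho>"
    and "\<bar>of_int i\<bar> \<le> I" "2 * \<rho> = of_int i * \<beta> + of_int j"
  shows "(\<beta>, \<rho>) \<in> states D K I"
  using assms unfolding states_def by auto

text \<open>A state is determined by its slope and the integers \<open>i\<close> and
  \<open>j\<close>. The slopes are finitely many, \<open>i\<close> is bounded by \<open>I\<close>,
  and \<open>0 < \<rho> < 1\<close> turns this into a bound on \<open>j\<close>.\<close>

lemma finite_states: "finite (states D K I)"
proof -
  \<comment> \<open>The summand 2 comes from \<open>j = 2 \<rho> - i \<beta>\<close>, where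
    \<open>2 \<rho> < 2\<close>.\<close>
  define N where "N = \<lceil>\<bar>I\<bar>\<rceil> + 2"
  have "states D K I \<subseteq> (\<lambda>(\<beta>, i :: int, j :: int). (\<beta>, (of_int i * \<beta> + of_int j) / 2)) `
      (bounded_quadratics D K \<times> {- N..N} \<times> {- N..N})"
  proof
    fix x
    assume "x \<in> states D K I"
    then obtain i j :: int where i: "\<bar>of_int i\<bar> \<le> I" and x: "2 * snd x = of_int i * fst x + of_int j"
      and b: "fst x \<in> bounded_quadratics D K" and r: "0 < snd x" "snd x < 1"
      unfolding states_def by auto
    have "0 < fst x" "fst x < 1"
      using b by (auto simp: bounded_quadratics_def)
    then have "\<bar>of_int i\<bar> * fst x \<le> \<bar>of_int i\<bar> * 1"
      by (intro mult_left_mono) auto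
    then have "\<bar>of_int i * fst x\<bar> \<le> I"
      using i \<open>0 < fst x\<close> by (simp add: abs_mult)
    then have "\<bar>of_int j\<bar> \<le> I + 2"
      using x r by linarith
    then have "\<bar>i\<bar> \<le> N" "\<bar>j\<bar> \<le> N"
      using i unfolding N_def by linarith+
    then have "(fst x, i, j) \<in> bounded_quadratics D K \<times> {- N..N} \<times> {- N..N}"
      using b by auto
    moreover have "x = (fst x, (of_int i * fst x + of_int j) / 2)"
      using x by (simp add: prod_eq_iff)
    ultimately show "x \<in> (\<lambda>(\<beta>, i :: int, j :: int). (\<beta>, (of_int i * \<beta> + of_int j) / 2)) `
      (bounded_quadratics D K \<times> {- N..N} \<times> {- N..N})"
      by (intro image_eqI[of _ _ "(fst x, i, j)"]) auto
  qed
  then show ?thesis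
    by (rule finite_subset) (simp add: finite_bounded_quadratics)
qed

lemma valid_states:
  assumes "x \<in> states D K I"
  shows "valid x"
proof -
  have "1/2 \<in> (\<rat> :: real set)"
    by simp
  moreover have "fst x \<notin> \<rat>"
    using assms unfolding states_def bounded_quadratics_def by auto
  ultimately have "fst x \<noteq> 1/2"
    by metis
  then show ?thesis
    using assms unfolding states_def valid_def bounded_quadratics_def by auto
qed

text \<open>The coefficient \<open>i\<close> is preserved, and \<open>j\<close> becomes
  \<open>2 - i - j\<close>.\<close>

lemma states_complement:
  assumes "x \<in> states D K I"
  shows "complement_state x \<in> states D K I"
proof (cases x)
  case (Pair \<beta> \<rho>)
  with assms obtain i j :: int where i: "\<bar>of_int i\<bar> \<le> I" and x: "2 * \<rho> = of_int i * \<beta> + of_int j"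
    unfolding states_def by auto
  have "2 * (1 - \<rho>) = of_int i * (1 - \<beta>) + of_int (2 - i - j)"
    using x by (simp add: algebra_simps)
  moreover have "\<beta> \<in> bounded_quadratics D K" "0 < \<rho>" "\<rho> < 1" "nondegenerate \<beta> \<rho>"
    using assms Pair unfolding states_def by auto
  ultimately have "(1 - \<beta>, 1 - \<rho>) \<in> states D K I"
    by (intro statesI[where j = "2 - i - j", OF bounded_quadratics_complement _ _ nondegenerate_complement i]) auto
  then show ?thesis
    using Pair by simp
qed

text \<open>A step maps \<open>i\<close> to \<open>(1 - \<beta>) i + 2 (\<rho> - d)\<close>, so \<open>\<bar>i\<bar> \<le> I\<close> persists if \<open>I \<ge> 2 / \<beta>\<close>.\<close>

lemma states_slow_aux:
  fixes d :: int
  assumes x: "(\<beta>, \<rho>) \<in> states D K I" and "\<beta> < 1/2" "D \<le> K" "2 / \<beta> \<le> I"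
    and d: "d = 0 \<or> d = 1" and r: "0 < (\<rho> - of_int d * \<beta>) / (1 - \<beta>)" "(\<rho> - of_int d * \<beta>) / (1 - \<beta>) < 1"
  shows "(\<beta> / (1 - \<beta>), (\<rho> - of_int d * \<beta>) / (1 - \<beta>)) \<in> states D K I"
proof -
  obtain i j :: int where i: "\<bar>of_int i\<bar> \<le> I" and eq: "2 * \<rho> = of_int i * \<beta> + of_int j"
    using x unfolding states_def by auto
  have \<beta>: "0 < \<beta>" "\<beta> < 1" "\<beta> \<in> bounded_quadratics D K" and \<rho>: "0 < \<rho>" "\<rho> < 1"
    and nd: "nondegenerate \<beta> \<rho>"
    using x unfolding states_def bounded_quadratics_def by auto
  have "of_int (i + j - 2 * d) = (1 - \<beta>) * of_int i + 2 * (\<rho> - of_int d)"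
    using eq by (simp add: algebra_simps)
  then have "\<bar>of_int (i + j - 2 * d) :: real\<bar> \<le> \<bar>(1 - \<beta>) * of_int i\<bar> + 2"
    using \<rho> d by auto
  also have "\<dots> = (1 - \<beta>) * \<bar>of_int i\<bar> + 2"
    using \<beta> by (simp add: abs_mult)
  also have "\<dots> \<le> (1 - \<beta>) * I + 2"
    using i \<beta> by (simp add: mult_left_mono)
  also have "\<dots> \<le> I"
    using assms(4) \<beta> by (simp add: field_simps)
  finally have "\<bar>of_int (i + j - 2 * d)\<bar> \<le> I" .
  moreover have "2 * ((\<rho> - of_int d * \<beta>) / (1 - \<beta>)) = of_int (i + j - 2 * d) * (\<beta> / (1 - \<beta>)) + of_int j"
  proof -
    have "2 * (\<rho> - of_int d * \<beta>) = of_int (i + j - 2 * d) * \<beta> + of_int j * (1 - \<beta>)"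
      using eq by (simp add: algebra_simps)
    then have "2 * (\<rho> - of_int d * \<beta>) / (1 - \<beta>)
      = (of_int (i + j - 2 * d) * \<beta> + of_int j * (1 - \<beta>)) / (1 - \<beta>)"
      by simp
    then show ?thesis
      using \<beta> by (simp add: add_divide_distrib)
  qed
  ultimately show ?thesis
    by (rule statesI[OF bounded_quadratics_slow[OF \<beta>(3) assms(2,3)] r nondegenerate_slow[OF nd \<beta>(2)]])
qed

lemma states_slow:
  assumes "x \<in> states D K I" "fst x < 1/2" "D \<le> K" "2 / fst x \<le> I"
  shows "slow_step x \<in> states D K I"
proof (cases x)
  case (Pair \<beta> \<rho>)
  have \<rho>: "0 < \<rho>" "\<rho> < 1" and \<beta>: "0 < \<beta>" "\<beta> < 1/2"
    using assms Pair unfolding states_def bounded_quadratics_def by auto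
  show ?thesis
  proof (cases "\<rho> < 1 - \<beta>")
    case True
    then show ?thesis
      using states_slow_aux[of \<beta> \<rho> D K I 0] assms Pair \<rho> \<beta> by simp
  next
    case False
    then show ?thesis
      using states_slow_aux[of \<beta> \<rho> D K I 1] assms Pair \<rho> \<beta> by simp
  qed
qed

lemma states_step:
  assumes "x \<in> states D K I" "D \<le> K" and I: "\<And>\<beta>. \<beta> \<in> bounded_quadratics D K \<Longrightarrow> 2 / \<beta> \<le> I"
  shows "step x \<in> states D K I"
proof (cases "fst x < 1/2")
  case True
  then show ?thesis
    using states_slow[OF assms(1) True assms(2)] I assms(1) by (simp add: step_def states_def)
next
  case False
  have c: "complement_state x \<in> states D K I"
    by (rule states_complement[OF assms(1)])
  then have "fst (complement_state x) < 1/2"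
    using False valid_states[OF assms(1)] by (cases x) (simp add: valid_def)
  then show ?thesis
    using states_slow[OF c _ assms(2)] I c False by (simp add: step_def states_def)
qed

lemma nondegenerate_half:
  assumes "\<alpha> \<notin> \<rat>"
  shows "nondegenerate \<alpha> (\<alpha> / 2)"
  unfolding nondegenerate_def
proof (intro allI notI)
  fix n k
  assume "of_int n * \<alpha> + \<alpha> / 2 = of_int k"
  then have eq: "of_int (2 * n + 1) * \<alpha> = of_int (2 * k)"
    by (simp add: algebra_simps)
  have "2 * n + 1 \<noteq> 0"
    by presburger
  then have "\<alpha> = of_int (2 * k) / of_int (2 * n + 1)"
    using eq by (metis nonzero_mult_div_cancel_left of_int_eq_0_iff)
  then show False
    using assms by (metis Rats_divide Rats_of_int)
qed

lemma substitutive_sturm_half: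
  assumes "0 < \<alpha>" "\<alpha> < 1" "quadratic_irrationality \<alpha>"
  shows "substitutive (sturm \<alpha> (\<alpha> / 2))"
proof -
  obtain A B C :: int where A: "A \<noteq> 0" and irr: "\<alpha> \<notin> \<rat>"
    and eq: "of_int A * \<alpha>\<^sup>2 + of_int B * \<alpha> + of_int C = 0"
    using assms(3) unfolding quadratic_irrationality_def by auto
  define D where "D = B\<^sup>2 - 4 * A * C"
  \<comment> \<open>\<open>K\<close> admits the given leading coefficient and also dominates the
    discriminant, as the bound for a slow step requires.\<close>
  define K where "K = max \<bar>A\<bar> D"
  have mem: "\<alpha> \<in> bounded_quadratics D K"
    unfolding bounded_quadratics_def using assms A eq irr D_def K_def
    by (intro CollectI conjI exI[of _ A] exI[of _ B] exI[of _ C]) auto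
  \<comment> \<open>The slopes form a finite set of positive numbers, so one \<open>I\<close> serves
    the whole orbit.\<close>
  obtain I where I: "\<And>\<beta>. \<beta> \<in> bounded_quadratics D K \<Longrightarrow> 2 / \<beta> \<le> I"
    using finite_imageI[OF finite_bounded_quadratics, THEN bdd_above_finite, of "\<lambda>\<beta>. 2 / \<beta>" D K]
    unfolding bdd_above_def by auto
  have "1 \<le> 2 / \<alpha>"
    using assms by simp
  then have "1 \<le> I"
    using I[OF mem] by linarith
  then have "(\<alpha>, \<alpha> / 2) \<in> states D K I"
    using mem assms nondegenerate_half[OF irr] by (intro statesI[where i = 1 and j = 0]) auto
  then have st: "(step ^^ n) (\<alpha>, \<alpha> / 2) \<in> states D K I" for n
    by (induction n) (auto intro!: states_step I simp: K_def)
  then have "finite (range (\<lambda>n. (step ^^ n) (\<alpha>, \<alpha> / 2)))"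
    using finite_states by (meson finite_subset image_subsetI)
  then have "substitutive (word (\<alpha>, \<alpha> / 2))"
    using substitutive_if_finite_orbit valid_states[OF st] by blast
  then show ?thesis
    by (simp add: word_def)
qed

section \<open>The rotation word\<close>

lemma bit_eqI: "(a = 1 \<longleftrightarrow> b = 1) \<Longrightarrow> a = b" for a b :: bit
  by (cases a; cases b) simp_all

lemma rotation_to_circle: "rotation \<alpha> (to_circle x) = to_circle (x + \<alpha>)"
  by (rule rotation.abs_eq)

lemma inv_rotation: "inv (rotation \<alpha>) = rotation (- \<alpha>)"
proof (rule inv_unique_comp)
  have "rotation \<alpha> (rotation (- \<alpha>) x) = x" "rotation (- \<alpha>) (rotation \<alpha> x) = x" for x
    by (induction x rule: circle.abs_induct; simp add: rotation_to_circle)+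
  then show "rotation \<alpha> \<circ> rotation (- \<alpha>) = id" "rotation (- \<alpha>) \<circ> rotation \<alpha> = id"
    by auto
qed

lemma int_iterate_rotation:
  "int_iterate (rotation \<alpha>) n (to_circle c) = to_circle (c + of_int n * \<alpha>)"
proof -
  have "(rotation \<theta> ^^ k) (to_circle c) = to_circle (c + real k * \<theta>)" for \<theta> k
    by (induction k) (simp_all add: rotation_to_circle algebra_simps)
  then show ?thesis
    by (simp add: int_iterate_def inv_rotation)
qed

text \<open>Hitting an endpoint would make an odd multiple of \<alpha> an even integer. So the orbit
  of the midpoint avoids the endpoints of the arc, and every choice of endpoints yields the same
  word.\<close>

lemma half_interval_open:
  fixes \<alpha> :: real
  assumes "\<alpha> \<notin> \<rat>" "\<bar>of_int n * \<alpha> - of_int k\<bar> \<le> \<alpha> / 2"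
  shows "\<bar>of_int n * \<alpha> - of_int k\<bar> < \<alpha> / 2"
proof -
  have "of_int n * \<alpha> + \<alpha> / 2 \<noteq> of_int k" "of_int (n - 1) * \<alpha> + \<alpha> / 2 \<noteq> of_int k"
    using nondegenerate_half[OF assms(1)] unfolding nondegenerate_def by blast+
  then have "of_int n * \<alpha> + \<alpha> / 2 \<noteq> of_int k" "of_int n * \<alpha> - \<alpha> / 2 \<noteq> of_int k"
    by (simp_all add: algebra_simps)
  then show ?thesis
    using assms(2) by linarith
qed

text \<open>With intercept \<open>\<alpha> / 2\<close> the two floors are taken at
  \<open>n \<alpha> - \<alpha> / 2\<close> and \<open>n \<alpha> + \<alpha> / 2\<close>, and they
  differ exactly when an integer separates these points.\<close>

lemma sturm_half_iff:
  assumes "0 < \<alpha>" "\<alpha> < 1" "\<alpha> \<notin> \<rat>"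
  shows "sturm \<alpha> (\<alpha> / 2) n = 1 \<longleftrightarrow> (\<exists>k. \<bar>of_int n * \<alpha> - of_int k\<bar> < \<alpha> / 2)"
proof -
  have eq: "of_int (n - 1) * \<alpha> + \<alpha> / 2 = of_int n * \<alpha> - \<alpha> / 2"
    by (simp add: algebra_simps)
  have "sturm \<alpha> (\<alpha> / 2) n = 1 \<longleftrightarrow> \<lfloor>of_int n * \<alpha> + \<alpha> / 2\<rfloor> \<noteq> \<lfloor>of_int n * \<alpha> - \<alpha> / 2\<rfloor>"
    unfolding sturm_def eq by simp
  also have "\<dots> \<longleftrightarrow> (\<exists>k. \<bar>of_int n * \<alpha> - of_int k\<bar> < \<alpha> / 2)"
  proof
    assume "\<lfloor>of_int n * \<alpha> + \<alpha> / 2\<rfloor> \<noteq> \<lfloor>of_int n * \<alpha> - \<alpha> / 2\<rfloor>"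
    then have "\<lfloor>of_int n * \<alpha> - \<alpha> / 2\<rfloor> < \<lfloor>of_int n * \<alpha> + \<alpha> / 2\<rfloor>"
      using floor_mono[of "of_int n * \<alpha> - \<alpha> / 2" "of_int n * \<alpha> + \<alpha> / 2"] assms(1) by simp
    then have "\<bar>of_int n * \<alpha> - of_int \<lfloor>of_int n * \<alpha> + \<alpha> / 2\<rfloor>\<bar> \<le> \<alpha> / 2"
      by linarith
    then show "\<exists>k. \<bar>of_int n * \<alpha> - of_int k\<bar> < \<alpha> / 2"
      using half_interval_open[OF assms(3)] by blast
  next
    assume "\<exists>k. \<bar>of_int n * \<alpha> - of_int k\<bar> < \<alpha> / 2"
    then obtain k where "\<bar>of_int n * \<alpha> - of_int k\<bar> < \<alpha> / 2"
      by blast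
    then have "\<lfloor>of_int n * \<alpha> - \<alpha> / 2\<rfloor> < k" "k \<le> \<lfloor>of_int n * \<alpha> + \<alpha> / 2\<rfloor>"
      unfolding floor_less_iff le_floor_iff by linarith+
    then show "\<lfloor>of_int n * \<alpha> + \<alpha> / 2\<rfloor> \<noteq> \<lfloor>of_int n * \<alpha> - \<alpha> / 2\<rfloor>"
      by linarith
  qed
  finally show ?thesis .
qed

lemma symbolic_word_rotation_eq_sturm:
  assumes \<alpha>: "0 < \<alpha>" "\<alpha> < 1" "\<alpha> \<notin> \<rat>" and arc: "is_arc U \<alpha> m"
  shows "symbolic_word (rotation \<alpha>) m U = sturm \<alpha> (\<alpha> / 2)"
proof
  fix n
  obtain c I where m: "m = to_circle c" and I: "{c - \<alpha> / 2 <..< c + \<alpha> / 2} \<subseteq> I"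
    "I \<subseteq> {c - \<alpha> / 2 .. c + \<alpha> / 2}" and U: "U = to_circle ` I"
    using arc unfolding is_arc_def by blast
  have "to_circle (c + of_int n * \<alpha>) \<in> U \<longleftrightarrow> (\<exists>k. \<bar>of_int n * \<alpha> - of_int k\<bar> < \<alpha> / 2)"
  proof
    assume "to_circle (c + of_int n * \<alpha>) \<in> U"
    then obtain y where y: "y \<in> I" "c + of_int n * \<alpha> - y \<in> \<int>"
      unfolding U using circle.abs_eq_iff by blast
    then obtain k where "c + of_int n * \<alpha> - y = of_int k"
      using Ints_cases by blast
    moreover have "\<bar>y - c\<bar> \<le> \<alpha> / 2"
      using subsetD[OF I(2) y(1)] unfolding atLeastAtMost_iff by linarith
    ultimately have "\<bar>of_int n * \<alpha> - of_int k\<bar> \<le> \<alpha> / 2"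
      by linarith
    then show "\<exists>k. \<bar>of_int n * \<alpha> - of_int k\<bar> < \<alpha> / 2"
      using half_interval_open[OF \<alpha>(3)] by blast
  next
    assume "\<exists>k. \<bar>of_int n * \<alpha> - of_int k\<bar> < \<alpha> / 2"
    then obtain k where k: "\<bar>of_int n * \<alpha> - of_int k\<bar> < \<alpha> / 2"
      by blast
    have "c + of_int n * \<alpha> - of_int k \<in> {c - \<alpha> / 2 <..< c + \<alpha> / 2}"
      using k unfolding greaterThanLessThan_iff by linarith
    then have "c + of_int n * \<alpha> - of_int k \<in> I"
      using I(1) by blast
    moreover have "to_circle (c + of_int n * \<alpha>) = to_circle (c + of_int n * \<alpha> - of_int k)"
      by (simp add: circle.abs_eq_iff)
    ultimately show "to_circle (c + of_int n * \<alpha>) \<in> U"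
      unfolding U by blast
  qed
  then have "symbolic_word (rotation \<alpha>) m U n = 1 \<longleftrightarrow> sturm \<alpha> (\<alpha> / 2) n = 1"
    unfolding symbolic_word_def m int_iterate_rotation sturm_half_iff[OF \<alpha>] by auto
  then show "symbolic_word (rotation \<alpha>) m U n = sturm \<alpha> (\<alpha> / 2) n"
    by (rule bit_eqI)
qed

text \<open>The criterion for the letter 1 is invariant under negating both \<open>n\<close> and
  \<open>k\<close>, so the word is symmetric about the letter at position 0.\<close>

lemma palindrome_sturm_half:
  assumes "0 < \<alpha>" "\<alpha> < 1" "\<alpha> \<notin> \<rat>"
  shows "palindrome (sturm \<alpha> (\<alpha> / 2))"
proof -
  have neg: "\<bar>of_int (- n) * \<alpha> - of_int k\<bar> = \<bar>of_int n * \<alpha> - of_int (- k)\<bar>" for n k :: int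
    using abs_minus_cancel[of "of_int n * \<alpha> - of_int (- k)"] by simp
  have "(\<exists>k. \<bar>of_int n * \<alpha> - of_int k\<bar> < \<alpha> / 2) \<longleftrightarrow>
      (\<exists>k. \<bar>of_int (- n) * \<alpha> - of_int k\<bar> < \<alpha> / 2)" for n
    unfolding neg by (metis minus_minus)
  then have "sturm \<alpha> (\<alpha> / 2) n = sturm \<alpha> (\<alpha> / 2) (- n)" for n
    unfolding sturm_half_iff[OF assms, symmetric] by (rule bit_eqI)
  then show ?thesis
    unfolding palindrome_def by blast
qed

section \<open>Letter frequencies of substitutive words\<close>

lemma count_ones_sturm:
  assumes "0 \<le> \<beta>" "\<beta> < 1"
  shows "int (count_list (map (sturm \<beta> \<rho>) [1..int N]) 1) = \<lfloor>real N * \<beta> + \<rho>\<rfloor> - \<lfloor>\<rho>\<rfloor>"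
proof (induction N)
  case (Suc N)
  have up: "[1..int (Suc N)] = [1..int N] @ [int (Suc N)]"
    using upto_rec2[of 1 "int (Suc N)"] by simp
  have prev: "int (Suc N) - 1 = int N"
    by simp
  have "int (count_list [sturm \<beta> \<rho> (int (Suc N))] 1) =
      \<lfloor>real (Suc N) * \<beta> + \<rho>\<rfloor> - \<lfloor>real N * \<beta> + \<rho>\<rfloor>"
    using floor_increment[OF assms, of "int (Suc N)" \<rho>]
    unfolding sturm_def prev of_int_of_nat_eq by (auto simp del: of_nat_Suc)
  then show ?case
    unfolding up map_append count_list_append of_nat_add Suc by simp
qed simp

definition freq :: "bit list \<Rightarrow> real" where
  "freq u = real (count_list u 1) / real (length u)"

text \<open>The ones telescope to the floor of \<open>N \<beta> + \<rho>\<close>, which differs from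
  \<open>N \<beta>\<close> by at most 1.\<close>

lemma freq_sturm_prefix:
  assumes "0 \<le> \<beta>" "\<beta> < 1" "0 \<le> \<rho>" "\<rho> < 1" "0 < N"
  shows "\<bar>freq (map (sturm \<beta> \<rho>) [1..int N]) - \<beta>\<bar> \<le> 1 / real N"
proof -
  define x where "x = count_list (map (sturm \<beta> \<rho>) [1..int N]) 1"
  have "int x = \<lfloor>real N * \<beta> + \<rho>\<rfloor>"
    using count_ones_sturm[OF assms(1,2), of \<rho> N] assms(3,4) unfolding x_def
    by (simp add: floor_eq_iff)
  then have "\<bar>real x - real N * \<beta>\<bar> \<le> 1"
    using assms(3,4) by linarith
  moreover have "real x / real N - \<beta> = (real x - real N * \<beta>) / real N"
    using assms(5) by (simp add: field_simps)
  ultimately show ?thesis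
    using assms(5) unfolding freq_def x_def[symmetric] by (simp add: divide_right_mono)
qed

lemma length_apply_word_ge:
  assumes "substitution h"
  shows "length u \<le> length (apply_word h u)"
proof (induction u)
  case (Cons c u)
  have "h c \<noteq> []"
    using assms by (simp add: substitution_def)
  then have "1 \<le> length (h c)"
    by (cases "h c") auto
  then show ?case
    using Cons by simp
qed simp

text \<open>\<open>apply_biword\<close> reads the letter of list index \<open>i\<close> from the
  image \<open>Y\<close> of the positions 1 to \<open>i + 1\<close>. One of \<open>?X\<close> and
  \<open>Y\<close> is a prefix of the other, and both are longer than \<open>i\<close>.\<close>

lemma apply_biword_prefix:
  assumes "substitution h"
  shows "apply_word h (map v [1..int N]) =
    map (apply_biword h v) [1..int (length (apply_word h (map v [1..int N])))]"
    (is "?X = _")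
proof (rule nth_equalityI)
  fix i
  assume i: "i < length ?X"
  define Y where "Y = apply_word h (map v [1..int i + 1])"
  have ylen: "i < length Y"
    using length_apply_word_ge[OF assms, of "map v [1..int i + 1]"] by (simp add: Y_def)
  have "?X ! i = Y ! i"
  proof (cases "i + 1 \<le> N")
    case True
    then have "[1..int N] = [1..int i + 1] @ [int i + 1 + 1..int N]"
      using upto_append[of 0 "int i + 1" "int N"] by simp
    then have "?X = Y @ apply_word h (map v [int i + 1 + 1..int N])"
      by (simp add: Y_def)
    then show ?thesis
      using ylen by (simp add: nth_append)
  next
    case False
    then have "[1..int i + 1] = [1..int N] @ [int N + 1..int i + 1]"
      using upto_append[of 0 "int N" "int i + 1"] by simp
    then have "Y = ?X @ apply_word h (map v [int N + 1..int i + 1])"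
      by (simp add: Y_def)
    then show ?thesis
      using i by (simp add: nth_append)
  qed
  then show "?X ! i = map (apply_biword h v) [1..int (length ?X)] ! i"
    using i by (simp add: apply_biword_def Y_def add.commute)
qed simp

section \<open>Action of a substitution on letter frequencies\<close>

lemma count_list_apply_word:
  "real (count_list (apply_word h u) 1) =
    (real (length u) - real (count_list u 1)) * real (count_list (h 0) 1)
    + real (count_list u 1) * real (count_list (h (1 :: bit)) 1)"
proof (induction u)
  case (Cons c u)
  then show ?case
    by (cases c) (simp_all add: algebra_simps)
qed simp

lemma length_apply_word:
  "real (length (apply_word h u)) =
    (real (length u) - real (count_list u 1)) * real (length (h 0))
    + real (count_list u 1) * real (length (h (1 :: bit)))"
proof (induction u)
  case (Cons c u)
  then show ?case
    by (cases c) (simp_all add: algebra_simps)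
qed simp

lemma freq_bounds: "0 \<le> freq u" "freq u \<le> 1"
  using count_le_length[of u 1] unfolding freq_def by (auto simp: divide_le_eq_1)

text \<open>The length of the image and its number of ones are linear in the letter counts of
  \<open>u\<close>. Divided by the length of \<open>u\<close> they become the two affine expressions
  in \<open>freq u\<close>. Here \<open>R\<close> and \<open>R + S\<close> are the lengths of
  \<open>h 0\<close> and \<open>h 1\<close>, hence positive.\<close>

lemma freq_apply_word_moebius:
  assumes "substitution h"
  obtains P Q R S :: int where "1 \<le> R" "1 \<le> R + S"
    "\<And>u. u \<noteq> [] \<Longrightarrow> freq (apply_word h u) * (of_int R + of_int S * freq u) = of_int P + of_int Q * freq u"
proof
  define P where "P = int (count_list (h 0) 1)"
  define Q where "Q = int (count_list (h 1) 1) - P"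
  define R where "R = int (length (h 0))"
  define S where "S = int (length (h 1)) - R"
  have ne: "h c \<noteq> []" for c
    using assms by (simp add: substitution_def)
  show "1 \<le> R" "1 \<le> R + S"
    using ne[of 0] ne[of 1] by (simp_all add: R_def S_def Suc_le_eq)
  show "freq (apply_word h u) * (of_int R + of_int S * freq u) = of_int P + of_int Q * freq u"
    if "u \<noteq> []" for u
  proof -
    have "apply_word h u \<noteq> []"
      using length_apply_word_ge[OF assms, of u] that by auto
    then have pos: "0 < real (length u)" "0 < real (length (apply_word h u))"
      using that by simp_all
    have x: "real (count_list u 1) = real (length u) * freq u"
      using pos by (simp add: freq_def)
    have "real (length (apply_word h u)) = real (length u) * (of_int R + of_int S * freq u)"
      unfolding length_apply_word x by (simp add: R_def S_def algebra_simps)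
    moreover have "real (count_list (apply_word h u) 1) = real (length u) * (of_int P + of_int Q * freq u)"
      unfolding count_list_apply_word x by (simp add: P_def Q_def algebra_simps)
    moreover have "freq (apply_word h u) * real (length (apply_word h u)) = real (count_list (apply_word h u) 1)"
      using pos by (simp add: freq_def)
    ultimately have "real (length u) * (freq (apply_word h u) * (of_int R + of_int S * freq u))
        = real (length u) * (of_int P + of_int Q * freq u)"
      by (simp add: algebra_simps)
    then show ?thesis
      using pos by simp
  qed
qed

section \<open>Quadratic limits of letter frequencies\<close>

lemma iterate_prolongable:
  assumes "substitution \<phi>" "\<phi> b = b # W" "W \<noteq> []"
  shows "\<exists>t. (apply_word \<phi> ^^ n) [b] = b # t \<and> n \<le> length t"
proof (induction n)
  case (Suc n)
  then obtain t where t: "(apply_word \<phi> ^^ n) [b] = b # t" "n \<le> length t"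
    by blast
  moreover have "1 \<le> length W"
    using assms(3) by (cases W) auto
  moreover have "length t \<le> length (apply_word \<phi> t)"
    by (rule length_apply_word_ge[OF assms(1)])
  ultimately show ?case
    using assms(2) by simp
qed simp

text \<open>Solving for \<open>x\<close> gives the quotient of \<open>N\<close> by \<open>M\<close>,
  both affine in \<open>y\<close>. Inserting it into the equation of \<open>x\<close> and clearing
  denominators gives the equation of \<open>y\<close>.\<close>

lemma quadratic_irrationality_moebius:
  fixes P Q R S :: int
  assumes q: "quadratic_irrationality x" and eq: "y * (of_int R + of_int S * x) = of_int P + of_int Q * x"
    and "y \<notin> \<rat>" "R \<noteq> 0"
  shows "quadratic_irrationality y"
proof -
  obtain a b c :: int where "a \<noteq> 0" and root: "of_int a * x\<^sup>2 + of_int b * x + of_int c = 0"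
    and irr: "x \<notin> \<rat>"
    using q unfolding quadratic_irrationality_def by auto
  define A where "A = a * R\<^sup>2 - b * R * S + c * S\<^sup>2"
  define B where "B = b * (R * Q + P * S) - 2 * a * R * P - 2 * c * Q * S"
  define C where "C = a * P\<^sup>2 - b * P * Q + c * Q\<^sup>2"
  define N where "N = y * of_int R - of_int P"
  define M where "M = of_int Q - y * of_int S"
  have N: "N = M * x"
    using eq by (simp add: N_def M_def algebra_simps)
  have "of_int A * y\<^sup>2 + of_int B * y + of_int C = of_int a * N\<^sup>2 + of_int b * N * M + of_int c * M\<^sup>2"
    by (simp add: A_def B_def C_def N_def M_def power2_eq_square algebra_simps)
  also have "\<dots> = M\<^sup>2 * (of_int a * x\<^sup>2 + of_int b * x + of_int c)"
    by (simp add: N power2_eq_square algebra_simps)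
  finally have "of_int A * y\<^sup>2 + of_int B * y + of_int C = 0"
    using root by simp
  moreover have "A \<noteq> 0"
  proof
    assume "A = 0"
    show False
    proof (cases "S = 0")
      case True
      then show False
        using \<open>A = 0\<close> \<open>a \<noteq> 0\<close> \<open>R \<noteq> 0\<close> by (simp add: A_def)
    next
      case False
      \<comment> \<open>\<open>A\<close> is \<open>S\<^sup>2\<close> times the polynomial of
        \<open>x\<close> at the pole \<open>t\<close> of the Moebius map. If it vanished, the
        polynomial would have a rational root, and its other root \<open>x\<close> would be rational
        too.\<close>
      define t :: real where "t = - of_int R / of_int S"
      have t: "t \<in> \<rat>"
        by (simp add: t_def)
      have "of_int a * t\<^sup>2 + of_int b * t + of_int c = of_int A / (of_int S)\<^sup>2"
        using False by (simp add: t_def A_def power2_eq_square field_simps)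
      then have "of_int a * t\<^sup>2 + of_int b * t + of_int c = 0"
        using \<open>A = 0\<close> by simp
      then have "(x - t) * (of_int a * (x + t) + of_int b) = 0"
        using root by (simp add: power2_eq_square algebra_simps)
      then have "of_int a * (x + t) + of_int b = 0"
        using t irr by auto
      then have "x = - of_int b / of_int a - t"
        using \<open>a \<noteq> 0\<close> by (simp add: field_simps)
      then have "x \<in> \<rat>"
        using t by simp
      then show False
        using irr by simp
    qed
  qed
  ultimately show ?thesis
    unfolding quadratic_irrationality_def using assms(3) by blast
qed

text \<open>Inverting the Moebius map of \<open>h\<close> carries the limit \<alpha> back to a limit
  \<open>x\<close> of the frequencies in \<open>u n\<close>, irrational since \<alpha> is. Passing
  to the limit in the recursion given by \<open>\<phi>\<close> makes \<open>x\<close> a fixed point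
  of an integral Moebius map, hence quadratic.\<close>

lemma quadratic_if_iterated_freq_limit:
  assumes \<phi>: "substitution \<phi>" and h: "substitution h" and ne: "u 0 \<noteq> []"
    and u: "\<And>n. u (Suc n) = apply_word \<phi> (u n)"
    and lim: "(\<lambda>n. freq (apply_word h (u n))) \<longlonglongrightarrow> \<alpha>" and irr: "\<alpha> \<notin> \<rat>"
  shows "quadratic_irrationality \<alpha>"
proof -
  have un: "u n \<noteq> []" for n
  proof (induction n)
    case (Suc n)
    then show ?case
      using length_apply_word_ge[OF \<phi>, of "u n"] u by auto
  qed (rule ne)
  define f where "f n = freq (u n)" for n
  define a where "a n = freq (apply_word h (u n))" for n
  have a: "a \<longlonglongrightarrow> \<alpha>"
    using lim by (simp add: a_def[abs_def])
  obtain P Q R S :: int where RS: "1 \<le> R" "1 \<le> R + S"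
    and "\<And>u. u \<noteq> [] \<Longrightarrow> freq (apply_word h u) * (of_int R + of_int S * freq u) = of_int P + of_int Q * freq u"
    by (rule freq_apply_word_moebius[OF h]) (rule that)
  then have af: "a n * (of_int R + of_int S * f n) = of_int P + of_int Q * f n" for n
    using un by (simp add: a_def f_def)
  obtain P' Q' R' S' :: int where RS': "1 \<le> R'" "1 \<le> R' + S'"
    and "\<And>u. u \<noteq> [] \<Longrightarrow> freq (apply_word \<phi> u) * (of_int R' + of_int S' * freq u) = of_int P' + of_int Q' * freq u"
    by (rule freq_apply_word_moebius[OF \<phi>]) (rule that)
  then have ff: "f (Suc n) * (of_int R' + of_int S' * f n) = of_int P' + of_int Q' * f n" for n
    using un by (simp add: f_def u)
  \<comment> \<open>If this vanished, irrationality of \<alpha> would force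
    \<open>S = Q = 0\<close>, and all frequencies \<open>a n\<close> would equal one rational
    number.\<close>
  have QS: "of_int Q - \<alpha> * of_int S \<noteq> 0"
  proof
    assume 0: "of_int Q - \<alpha> * of_int S = 0"
    have "S = 0"
    proof (rule ccontr)
      assume "S \<noteq> 0"
      then have "\<alpha> = of_int Q / of_int S"
        using 0 by (simp add: eq_divide_eq)
      then show False
        using irr by simp
    qed
    then have "Q = 0"
      using 0 by simp
    have "a n = of_int P / of_int R" for n
      using af[of n] RS(1) \<open>S = 0\<close> \<open>Q = 0\<close> by (simp add: eq_divide_eq)
    then have "a = (\<lambda>n. of_int P / of_int R)"
      by (rule ext)
    then have "(\<lambda>n. of_int P / of_int R) \<longlonglongrightarrow> \<alpha>"
      using a by (simp only:)
    then have "\<alpha> = of_int P / of_int R"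
      by (rule LIMSEQ_unique[OF _ tendsto_const])
    then show False
      using irr by simp
  qed
  define x where "x = (\<alpha> * of_int R - of_int P) / (of_int Q - \<alpha> * of_int S)"
  have den: "(\<lambda>n. of_int Q - a n * of_int S) \<longlonglongrightarrow> of_int Q - \<alpha> * of_int S"
    by (intro tendsto_diff tendsto_mult a tendsto_const)
  have "(\<lambda>n. (a n * of_int R - of_int P) / (of_int Q - a n * of_int S)) \<longlonglongrightarrow> x"
    unfolding x_def by (intro tendsto_divide den tendsto_diff tendsto_mult a tendsto_const QS)
  moreover have "\<forall>\<^sub>F n in sequentially. (a n * of_int R - of_int P) / (of_int Q - a n * of_int S) = f n"
    using tendsto_imp_eventually_ne[OF den QS]
  proof eventually_elim
    case (elim n)
    have "a n * of_int R - of_int P = f n * (of_int Q - a n * of_int S)"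
      using af[of n] by (simp add: algebra_simps)
    then show ?case
      using elim by simp
  qed
  ultimately have f: "f \<longlonglongrightarrow> x"
    by (rule Lim_transform_eventually)
  have x01: "0 \<le> x" "x \<le> 1"
    using LIMSEQ_le_const[OF f, of 0] LIMSEQ_le_const2[OF f, of 1] by (simp_all add: f_def freq_bounds)
  have \<alpha>x: "\<alpha> * (of_int R + of_int S * x) = of_int P + of_int Q * x"
  proof -
    have "x * (of_int Q - \<alpha> * of_int S) = \<alpha> * of_int R - of_int P"
      using QS by (simp add: x_def)
    then show ?thesis
      by (simp add: algebra_simps)
  qed
  have "x \<notin> \<rat>"
  proof
    assume "x \<in> \<rat>"
    \<comment> \<open>The denominator is a convex combination of the lengths of \<open>h 0\<close>
      and \<open>h 1\<close>, because \<open>x\<close> lies between 0 and 1.\<close>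
    have "0 < (1 - x) * of_int R + x * of_int (R + S)"
    proof -
      have "1 \<le> (of_int R :: real)" "1 \<le> (of_int (R + S) :: real)"
        using RS unfolding of_int_1_le_iff .
      then have "(1 - x) * 1 + x * 1 \<le> (1 - x) * of_int R + x * of_int (R + S)"
        using x01 by (intro add_mono mult_left_mono) simp_all
      then show ?thesis
        by simp
    qed
    then have "of_int R + of_int S * x \<noteq> 0"
      by (simp add: algebra_simps)
    then have "\<alpha> = (of_int P + of_int Q * x) / (of_int R + of_int S * x)"
      using \<alpha>x by (simp add: field_simps)
    then show False
      using irr \<open>x \<in> \<rat>\<close> by simp
  qed
  have "(\<lambda>n. f (Suc n) * (of_int R' + of_int S' * f n)) \<longlonglongrightarrow> x * (of_int R' + of_int S' * x)"
    by (intro tendsto_mult tendsto_add tendsto_const LIMSEQ_Suc[OF f] f)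
  moreover have "(\<lambda>n. of_int P' + of_int Q' * f n) \<longlonglongrightarrow> of_int P' + of_int Q' * x"
    by (intro tendsto_mult tendsto_add tendsto_const f)
  ultimately have fixpt: "x * (of_int R' + of_int S' * x) = of_int P' + of_int Q' * x"
    unfolding ff by (rule LIMSEQ_unique)
  have root: "of_int S' * x\<^sup>2 + of_int (R' - Q') * x + of_int (- P') = 0"
    using fixpt by (simp add: power2_eq_square algebra_simps)
  \<comment> \<open>Otherwise the equation is linear with an irrational solution, hence trivial. The
    map is then the identity, and the frequencies stay at the rational value of
    \<open>u 0\<close>.\<close>
  have "S' \<noteq> 0"
  proof
    assume "S' = 0"
    have "R' = Q'"
    proof (rule ccontr)
      assume "R' \<noteq> Q'"
      then have "x = of_int P' / of_int (R' - Q')"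
        using root \<open>S' = 0\<close> by (simp add: field_simps)
      then show False
        using \<open>x \<notin> \<rat>\<close> by (metis Rats_divide Rats_of_int)
    qed
    then have "P' = 0"
      using root \<open>S' = 0\<close> by simp
    have "f (Suc n) = f n" for n
      using ff[of n] \<open>S' = 0\<close> \<open>R' = Q'\<close> \<open>P' = 0\<close> RS' by simp
    then have "f n = freq (u 0)" for n
      by (induction n) (simp_all add: f_def)
    then have "f = (\<lambda>n. freq (u 0))"
      by (rule ext)
    then have "(\<lambda>n. freq (u 0)) \<longlonglongrightarrow> x"
      using f by (simp only:)
    then have "x = freq (u 0)"
      by (rule LIMSEQ_unique[OF _ tendsto_const])
    then show False
      using \<open>x \<notin> \<rat>\<close> by (simp add: freq_def)
  qed
  then have "quadratic_irrationality x"
    unfolding quadratic_irrationality_def using root \<open>x \<notin> \<rat>\<close> by blast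
  then show ?thesis
    using quadratic_irrationality_moebius[OF _ \<alpha>x irr] RS by simp
qed

text \<open>The words \<open>\<phi>^n(b)\<close> are prefixes of the right half of \<open>v\<close>
  of unbounded length. Their images under \<open>h\<close> are prefixes of the right half of the
  Sturmian word, so the frequencies of 1 in them tend to the slope.\<close>

lemma quadratic_if_substitutive_sturm:
  assumes "0 \<le> \<beta>" "\<beta> < 1" "0 \<le> \<rho>" "\<rho> < 1" "\<beta> \<notin> \<rat>" "substitutive (sturm \<beta> \<rho>)"
  shows "quadratic_irrationality \<beta>"
proof -
  obtain v h where v: "purely_substitutive v" and h: "substitution h"
    and eq: "sturm \<beta> \<rho> = apply_biword h v"
    using assms(6) unfolding substitutive_def by blast
  obtain b \<phi> W where \<phi>: "substitution \<phi>" "\<phi> b = b # W" "W \<noteq> []"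
    and pre: "\<And>n. prefix_of_right_half ((apply_word \<phi> ^^ n) [b]) v"
    using v unfolding purely_substitutive_def by blast
  define u where "u n = (apply_word \<phi> ^^ n) [b]" for n
  have len: "Suc n \<le> length (u n)" for n
    using iterate_prolongable[OF \<phi>, of n] by (auto simp: u_def)
  have "\<bar>freq (apply_word h (u n)) - \<beta>\<bar> \<le> inverse (real (Suc n))" for n
  proof -
    define L where "L = length (apply_word h (u n))"
    have "u n = map v [1..int (length (u n))]"
      using pre[of n] by (simp add: prefix_of_right_half_def u_def)
    then have "apply_word h (u n) = map (sturm \<beta> \<rho>) [1..int L]"
      using apply_biword_prefix[OF h, of v "length (u n)"] by (simp add: eq L_def)
    moreover have "Suc n \<le> L"
      using len[of n] length_apply_word_ge[OF h, of "u n"] by (simp add: L_def)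
    ultimately have "\<bar>freq (apply_word h (u n)) - \<beta>\<bar> \<le> 1 / real L"
      using freq_sturm_prefix[OF assms(1-4), of L] by simp
    also have "\<dots> \<le> inverse (real (Suc n))"
      using \<open>Suc n \<le> L\<close> by (simp add: inverse_eq_divide frac_le)
    finally show ?thesis .
  qed
  then have "(\<lambda>n. freq (apply_word h (u n)) - \<beta>) \<longlonglongrightarrow> 0"
    by (intro tendsto_0_le[OF LIMSEQ_inverse_real_of_nat, where K = 1]) simp
  then have "(\<lambda>n. freq (apply_word h (u n))) \<longlonglongrightarrow> \<beta>"
    by (simp add: LIM_zero_iff)
  then show ?thesis
    using quadratic_if_iterated_freq_limit[OF \<phi>(1) h, of u] assms(5) by (simp add: u_def)
qed

theorem mainTheorem1:
  fixes \<alpha> :: real and U :: "circle set" and x\<^sub>m :: circle and p :: "bit biword"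
  assumes "0 < \<alpha>" and "\<alpha> < 1" and "\<alpha> \<notin> \<rat>"
    and "is_arc U \<alpha> x\<^sub>m"
    and "p = symbolic_word (rotation \<alpha>) x\<^sub>m U"
  shows "(substitutive p \<and> palindrome p) \<longleftrightarrow> quadratic_irrationality \<alpha>"
proof -
  have "p = sturm \<alpha> (\<alpha> / 2)"
    using symbolic_word_rotation_eq_sturm assms by simp
  then show ?thesis
    using palindrome_sturm_half[OF assms(1-3)] substitutive_sturm_half[OF assms(1,2)]
      quadratic_if_substitutive_sturm[of \<alpha> "\<alpha> / 2"] assms(1-3) by auto
qed

end
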